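(* Let $\varphi(t)=2^{1/4}e^{-\pi t^2}$ for $t\in\mathbb{R}$, let $Q=[0,1)^2$, and let $\Theta=Z\varphi$ be the Zak transform of $\varphi$. Then $1/\Theta\notin L^2(Q)$, but $\rho_{1/2,1/2}/\Theta\in L^2(Q)$. Consequently, the Gabor system $G(\varphi,\mathbb{Z}^2)$ does not possess a reproducing partner in $L^2(\mathbb{R})$.
   Context: The Zak transform is the unitary map $Z:L^2(\mathbb{R})\to L^2(Q)$, $Zf(x,\xi)=\sum_{j\in\mathbb{Z}} f(x-j)\,e^{2\pi i j\xi}$ for $(x,\xi)\in Q$, where the series converges unconditionally in the norm of $L^2(Q)$. The function $\rho_{1/2,1/2}$ is $\rho_{1/2,1/2}(x,\xi)=\sqrt{(x-\tfrac12)^2+(\xi-\tfrac12)^2}$. The Gabor system is $G(\varphi,\mathbb{Z}^2)=\{M_n T_k \varphi\}_{(k,n)\in\mathbb{Z}^2}$, where $(M_n T_k \varphi)(t)=e^{2\pi i n t}\varphi(t-k)$. For a Hilbert space $\mathbb{H}$ (inner product linear in the first variable) and families $\Psi=\{\psi_i\}_{i\in I}$, $\Phi=\{\phi_i\}_{i\in I}$ in $\mathbb{H}$ with the same countable index set $I$, $(\Psi,\Phi)$ is a reproducing pair for $\mathbb{H}$, and $\Psi$ is a reproducing partner for $\Phi$, if there is a fixed ordering (enumeration) of $I$ such that, for all $f,g\in\mathbb{H}$, the partial sums of $\sum_{i\in I}\langle f,\psi_i\rangle\langle\phi_i,g\rangle$ converge with respect to that ordering, and the operator $S_{\Psi,\Phi}:\mathbb{H}\to\mathbb{H}$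 weakly defined by $\langle S_{\Psi,\Phi}f,g\rangle=\sum_{i\in I}\langle f,\psi_i\rangle\langle\phi_i,g\rangle$ is bounded and boundedly invertible. *)

theory Defs
  imports "HOL-Analysis.Analysis"
begin

text \<open>
  \<open>L2 M\<close> consists of functions rather than of classes of functions, so equality of
  vectors in the Hilbert space \<open>L\<^sup>2(M)\<close> is equality almost everywhere. For \<open>M = lborel\<close>
  the representatives are Borel measurable; since every Lebesgue measurable function agrees
  almost everywhere with a Borel one, the space of classes is the usual one.
\<close>

definition L2 :: "'a measure \<Rightarrow> ('a \<Rightarrow> complex) set" where
  "L2 M = {f \<in> borel_measurable M. integrable M (\<lambda>x. (norm (f x))\<^sup>2)}"

definition L2_inner :: "'a measure \<Rightarrow> ('a \<Rightarrow> complex) \<Rightarrow> ('a \<Rightarrow> complex) \<Rightarrow> complex" where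
  "L2_inner M f g = (LINT x|M. f x * cnj (g x))"

definition L2_norm :: "'a measure \<Rightarrow> ('a \<Rightarrow> complex) \<Rightarrow> real" where
  "L2_norm M f = sqrt (LINT x|M. (norm (f x))\<^sup>2)"

text \<open>
  Bounded linear operators on \<open>L\<^sup>2(M)\<close>. Compatibility with equality almost everywhere
  follows from linearity and the norm bound.
\<close>

definition L2_bounded_operator ::
    "'a measure \<Rightarrow> (('a \<Rightarrow> complex) \<Rightarrow> ('a \<Rightarrow> complex)) \<Rightarrow> bool" where
  "L2_bounded_operator M T \<longleftrightarrow>
     (\<forall>f\<in>L2 M. T f \<in> L2 M) \<and>
     (\<forall>f\<in>L2 M. \<forall>g\<in>L2 M. \<forall>a b.
        AE x in M. T (\<lambda>y. a * f y + b * g y) x = a * T f x + b * T g x) \<and>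
     (\<exists>C. \<forall>f\<in>L2 M. L2_norm M (T f) \<le> C * L2_norm M f)"

definition L2_boundedly_invertible ::
    "'a measure \<Rightarrow> (('a \<Rightarrow> complex) \<Rightarrow> ('a \<Rightarrow> complex)) \<Rightarrow> bool" where
  "L2_boundedly_invertible M S \<longleftrightarrow>
     (\<exists>T. L2_bounded_operator M T \<and>
        (\<forall>f\<in>L2 M. (AE x in M. T (S f) x = f x) \<and> (AE x in M. S (T f) x = f x)))"

text \<open>
  The ordering of the countable index set \<open>I\<close> is a bijection \<open>e\<close> from \<open>J\<close> onto \<open>I\<close>, where
  \<open>J\<close> is all of the natural numbers (\<open>I\<close> infinite) or an initial segment (\<open>I\<close> finite). It is
  chosen before \<open>f\<close> and \<open>g\<close>. The operator \<open>S\<close> is determined up to equality almost everywhere.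
\<close>

definition reproducing_pair ::
    "'a measure \<Rightarrow> 'i set \<Rightarrow> ('i \<Rightarrow> 'a \<Rightarrow> complex) \<Rightarrow> ('i \<Rightarrow> 'a \<Rightarrow> complex) \<Rightarrow> bool" where
  "reproducing_pair M I \<psi> \<phi> \<longleftrightarrow>
     (\<forall>i\<in>I. \<psi> i \<in> L2 M) \<and> (\<forall>i\<in>I. \<phi> i \<in> L2 M) \<and>
     (\<exists>(J :: nat set) e. (J = UNIV \<or> (\<exists>m. J = {..<m})) \<and> bij_betw e J I \<and>
        (\<exists>S. L2_bounded_operator M S \<and> L2_boundedly_invertible M S \<and>
          (\<forall>f\<in>L2 M. \<forall>g\<in>L2 M.
            (\<lambda>N. \<Sum>n\<in>J \<inter> {..<N}. L2_inner M f (\<psi> (e n)) * L2_inner M (\<phi> (e n)) g)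
              \<longlonglongrightarrow> L2_inner M (S f) g)))"

definition has_reproducing_partner ::
    "'a measure \<Rightarrow> 'i set \<Rightarrow> ('i \<Rightarrow> 'a \<Rightarrow> complex) \<Rightarrow> bool" where
  "has_reproducing_partner M I \<phi> \<longleftrightarrow> (\<exists>\<psi>. reproducing_pair M I \<psi> \<phi>)"

definition unit_square :: "(real \<times> real) set" where
  "unit_square = {0..<1} \<times> {0..<1}"

abbreviation square_measure :: "(real \<times> real) measure" where
  "square_measure \<equiv> restrict_space lborel unit_square"

text \<open>
  The Zak series converges unconditionally in the norm of \<open>L\<^sup>2(Q)\<close>, that is, along the net of
  finite subsets of the integers. The limit is unique only up to equality almost everywhere, so
  \<open>Zak f\<close> is a chosen representative.
\<close>

definition has_zak_transform :: "(real \<Rightarrow> complex) \<Rightarrow> (real \<times> real \<Rightarrow> complex) \<Rightarrow> bool" where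
  "has_zak_transform f F \<longleftrightarrow> F \<in> L2 square_measure \<and>
     ((\<lambda>A. L2_norm square_measure
             (\<lambda>(x, \<xi>). (\<Sum>j\<in>A. f (x - of_int j) * exp (2 * pi * \<i> * of_int j * of_real \<xi>))
                         - F (x, \<xi>)))
        \<longlongrightarrow> 0) (finite_subsets_at_top (UNIV :: int set))"

definition Zak :: "(real \<Rightarrow> complex) \<Rightarrow> real \<times> real \<Rightarrow> complex" where
  "Zak f = (SOME F. has_zak_transform f F)"

definition rho :: "real \<Rightarrow> real \<Rightarrow> real \<times> real \<Rightarrow> real" where
  "rho a b = (\<lambda>(x, \<xi>). sqrt ((x - a)\<^sup>2 + (\<xi> - b)\<^sup>2))"

definition translation :: "real \<Rightarrow> (real \<Rightarrow> complex) \<Rightarrow> real \<Rightarrow> complex" where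
  "translation a f = (\<lambda>t. f (t - a))"

definition modulation :: "real \<Rightarrow> (real \<Rightarrow> complex) \<Rightarrow> real \<Rightarrow> complex" where
  "modulation b f = (\<lambda>t. exp (2 * pi * \<i> * of_real b * of_real t) * f t)"

definition gabor_system :: "(real \<Rightarrow> complex) \<Rightarrow> int \<times> int \<Rightarrow> real \<Rightarrow> complex" where
  "gabor_system f = (\<lambda>(k, n). modulation (of_int n) (translation (of_int k) f))"

definition gaussian :: "real \<Rightarrow> complex" where
  "gaussian t = of_real (2 powr (1/4) * exp (- pi * t\<^sup>2))"

end

theory Submission
  imports Defs "HOL-Probability.Sinc_Integral"
begin

text \<open>
  Pairing the summands \<open>j = m + 1\<close> and \<open>j = -m\<close> of the Zak series of the Gaussian around the point
  \<open>(1/2, 1/2)\<close> turns it into a series in \<open>sinh ((2m + 1) y)\<close> with \<open>y = \<pi> ((x - 1/2) + \<i> (\<xi> - 1/2))\<close>,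
  which on the square is dominated by its first term. Hence \<open>\<bar>\<Theta>\<bar>\<close> lies between two multiples
  of \<open>\<rho>\<close>, and everything about \<open>\<Theta>\<close> follows because \<open>1 / \<rho>\<^sup>2\<close> is not integrable in the plane.

  For the reproducing partner, the inverse Zak transform of \<open>1 / cnj \<Theta>\<close> is available in closed form:
  it is a multiple of \<open>\<gamma>(t) = exp (\<pi> t\<^sup>2) \<Sum>\<^bsub>n \<ge> \<bar>t\<bar> - 1/2\<^esub> (-1)\<^sup>n exp (-\<pi> (n + 1/2)\<^sup>2)\<close> (Bastiaans' dual window).
  It is bounded but not square integrable, and it is biorthogonal to the Gabor system. The functions
  \<open>\<gamma>\<^sub>n(t) = \<gamma>(t) (1 - exp (2\<pi>\<i>n(t - 1/2)))\<close> are square integrable. A reproducing partner would expand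
  every \<open>u\<close> with coefficients \<open>c\<close> for which \<open>\<langle>u, \<gamma>\<^sub>n\<rangle>\<close> is a multiple of \<open>c\<^bsub>0,0\<^esub> \<plusminus> c\<^bsub>0,n\<^esub>\<close> and
  \<open>c\<^bsub>0,n\<^esub>\<close> is bounded in \<open>n\<close>. Averaging over \<open>n\<close> and Fatou's lemma would make \<open>u \<gamma>\<close> integrable,
  which fails for a suitable \<open>u\<close> concentrated just to the left of the positive half-integers.
\<close>

section \<open>Coefficients and hyperbolic estimates\<close>

text \<open>Up to sign and a factor 2 these are the coefficients of the Jacobi theta function
  theta_1 with nome exp(-\<pi>).\<close>

definition gauss_coeff :: "nat \<Rightarrow> real" where
  "gauss_coeff m = exp (- pi * (real m + 1/2)\<^sup>2)"

lemma gauss_coeff_pos: "gauss_coeff m > 0"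
  by (simp add: gauss_coeff_def)

lemma exp_minus_pi_le: "exp (- pi) \<le> 1 / 12"
proof -
  have "(5/2 :: real) \<le> exp 1"
    using exp_lower_Taylor_quadratic[of 1] by simp
  then have "(5/2 :: real) ^ 3 \<le> exp 1 ^ 3"
    by (intro power_mono) auto
  also have "exp (1::real) ^ 3 = exp 3"
    by (simp flip: exp_of_nat_mult)
  also have "\<dots> \<le> exp pi"
    using pi_gt3 by simp
  finally have "12 \<le> exp pi" by (simp add: power3_eq_cube)
  then show ?thesis
    by (simp add: exp_minus field_simps)
qed

text \<open>With M = m + 1, (M + 1/2)^2 = 1/4 + M + M^2, so exp(\<pi> M) cancels the linear part and
  exp(-\<pi> M^2) \<le> 12^(-M) remains. The linear factor is at most 3^M, whence the ratio 3/12 =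
  1/4. Both extra factors are those of \<open>norm_sinh_odd_multiple_le\<close> for r =
  \<pi>.\<close>

lemma gauss_coeff_decay:
  "gauss_coeff (Suc m) * (2 * real (Suc m) + 1) * exp (pi * real (Suc m)) \<le> gauss_coeff 0 * (1/4) ^ Suc m"
proof -
  have lin: "2 * real (Suc m) + 1 \<le> 3 ^ Suc m"
    by (induction m) auto
  have "gauss_coeff (Suc m) * exp (pi * real (Suc m)) = gauss_coeff 0 * exp (- pi * (real (Suc m))\<^sup>2)"
    unfolding gauss_coeff_def exp_add [symmetric] by (simp add: power2_eq_square algebra_simps flip: exp_add)
  also have "\<dots> \<le> gauss_coeff 0 * exp (- pi * real (Suc m))"
    by (intro mult_left_mono) (auto simp: gauss_coeff_def power2_eq_square)
  also have "exp (- pi * real (Suc m)) = exp (- pi) ^ Suc m"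
    by (simp only: exp_of_nat2_mult)
  also have "\<dots> \<le> (1/12) ^ Suc m"
    by (intro power_mono exp_minus_pi_le) simp
  finally have "gauss_coeff (Suc m) * exp (pi * real (Suc m)) \<le> gauss_coeff 0 * (1/12) ^ Suc m"
    using gauss_coeff_pos[of 0] by (simp add: mult_left_mono)
  then have "gauss_coeff (Suc m) * exp (pi * real (Suc m)) * (2 * real (Suc m) + 1)
      \<le> gauss_coeff 0 * (1/12) ^ Suc m * 3 ^ Suc m"
    by (rule mult_mono[OF _ lin]) (simp_all add: gauss_coeff_pos less_imp_le)
  also have "\<dots> = gauss_coeff 0 * (1/4) ^ Suc m"
    by (simp add: power_mult_distrib [symmetric] mult.assoc)
  finally show ?thesis by (simp add: mult_ac)
qed

text \<open>The tail is majorised by a geometric series with sum K/3. In the applications K is the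
  norm of \<open>f 0\<close>, so the whole sum stays within a third of its first term and cannot
  vanish unless that term does.\<close>

lemma norm_suminf_minus_head_le:
  fixes f :: "nat \<Rightarrow> 'a::banach"
  assumes "\<And>m. norm (f (Suc m)) \<le> K * (1/4) ^ Suc m"
  shows "summable f" "norm (suminf f - f 0) \<le> K / 3"
proof -
  have g: "(\<lambda>m. K * (1/4) ^ Suc m) sums (K / 3)"
    using sums_mult[OF sums_mult[OF geometric_sums[of "1/4::real"], of "1/4"], of K] by simp
  have s: "summable (\<lambda>m. norm (f (Suc m)))"
    by (rule summable_comparison_test'[OF sums_summable[OF g], of 0]) (use assms in auto)
  then have s': "summable (\<lambda>m. f (Suc m))" by (rule summable_norm_cancel)
  then show sf: "summable f" by (simp add: summable_Suc_iff)
  have "norm (suminf f - f 0) = norm (\<Sum>m. f (Suc m))"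
    using suminf_split_head[OF sf] by simp
  also have "\<dots> \<le> (\<Sum>m. norm (f (Suc m)))" by (rule summable_norm[OF s])
  also have "\<dots> \<le> (\<Sum>m. K * (1/4) ^ Suc m)"
    by (rule suminf_le[OF assms s sums_summable[OF g]])
  also have "\<dots> = K / 3" using g by (simp add: sums_iff)
  finally show "norm (suminf f - f 0) \<le> K / 3" .
qed

text \<open>The intervals [-N, N) exhaust the integers and grow by the two indices N and -1-N, so
  the limit along finite sets restricts to paired partial sums.\<close>

lemma sums_pair_int:
  fixes f :: "int \<Rightarrow> 'a::real_normed_vector"
  assumes "(f has_sum s) UNIV"
  shows "(\<lambda>m. f (int m) + f (- 1 - int m)) sums s"
proof -
  have "filterlim (\<lambda>N. {- int N..<int N}) (finite_subsets_at_top UNIV) sequentially"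
    unfolding filterlim_finite_subsets_at_top
  proof safe
    fix X :: "int set" assume "finite X"
    then obtain M where M: "\<forall>x\<in>X. \<bar>x\<bar> \<le> M"
      using finite_abs_int_segment finite_subset by (metis abs_ge_self bdd_above.unfold bdd_above_finite finite_imageI imageI)
    show "\<forall>\<^sub>F N in sequentially. finite {- int N..<int N} \<and> X \<subseteq> {- int N..<int N} \<and> {- int N..<int N} \<subseteq> UNIV"
      using eventually_gt_at_top[of "nat M"]
      by eventually_elim (use M in force)
  qed
  with assms have "(\<lambda>N. sum f {- int N..<int N}) \<longlonglongrightarrow> s"
    unfolding has_sum_def by (rule filterlim_compose)
  moreover have "sum f {- int N..<int N} = (\<Sum>m<N. f (int m) + f (- 1 - int m))" for N
  proof (induction N)
    case (Suc N)
    have "{- int (Suc N)..<int (Suc N)} = insert (int N) (insert (- 1 - int N) {- int N..<int N})"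
      by auto
    then show ?case using Suc.IH by (simp add: add_ac)
  qed simp
  ultimately show ?thesis by (simp add: sums_def)
qed

section \<open>Bounds for hyperbolic functions of a complex variable\<close>

lemma norm_cosh_le: "norm (cosh z) \<le> exp \<bar>Re z\<bar>" for z :: complex
proof -
  have "norm (cosh z) \<le> (norm (exp z) + norm (exp (- z))) / 2"
    unfolding cosh_field_def using norm_triangle_ineq[of "exp z" "exp (- z)"] by (simp add: norm_divide)
  also have "\<dots> \<le> exp \<bar>Re z\<bar>"
  proof -
    have "exp (Re z) \<le> exp \<bar>Re z\<bar>" "exp (- Re z) \<le> exp \<bar>Re z\<bar>" by auto
    from add_mono[OF this] show ?thesis by simp
  qed
  finally show ?thesis .
qed

text \<open>Induction over sinh((2m+3)y) = sinh((2m+1)y) + 2 cosh((2m+2)y) sinh y. Keeping the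
  factor |sinh y| makes the bound sharp enough near the zero y = 0.\<close>

lemma norm_sinh_odd_multiple_le:
  fixes y :: complex
  assumes "2 * \<bar>Re y\<bar> \<le> r"
  shows "norm (sinh (of_nat (2 * m + 1) * y)) \<le> (2 * real m + 1) * exp (r * real m) * norm (sinh y)"
proof (induction m)
  case 0
  then show ?case by simp
next
  case (Suc m)
  have r0: "r \<ge> 0" using assms by (smt (verit) abs_ge_zero)
  let ?c = "of_nat (2 * m + 2) * y"
  have "sinh (of_nat (2 * Suc m + 1) * y) = sinh (?c + y)" "sinh (of_nat (2 * m + 1) * y) = sinh (?c - y)"
    by (simp_all add: algebra_simps)
  then have eq: "sinh (of_nat (2 * Suc m + 1) * y) = sinh (of_nat (2 * m + 1) * y) + 2 * cosh ?c * sinh y"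
    by (simp add: sinh_add sinh_diff)
  have "norm (cosh ?c) \<le> exp \<bar>Re ?c\<bar>" by (rule norm_cosh_le)
  also have "\<bar>Re ?c\<bar> = real (Suc m) * (2 * \<bar>Re y\<bar>)"
    by (simp add: abs_mult)
  also have "exp \<dots> \<le> exp (r * real (Suc m))"
    using assms mult_left_mono[OF assms, of "real (Suc m)"] by (simp add: mult.commute)
  finally have c: "norm (cosh ?c) \<le> exp (r * real (Suc m))" .
  have "norm (sinh (of_nat (2 * Suc m + 1) * y))
      \<le> norm (sinh (of_nat (2 * m + 1) * y)) + norm (2 * cosh ?c * sinh y)"
    unfolding eq by (rule norm_triangle_ineq)
  also have "\<dots> \<le> (2 * real m + 1) * exp (r * real m) * norm (sinh y)
      + 2 * exp (r * real (Suc m)) * norm (sinh y)"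
    unfolding norm_mult using c by (intro add_mono Suc.IH mult_right_mono) auto
  also have "\<dots> \<le> (2 * real m + 1) * exp (r * real (Suc m)) * norm (sinh y)
      + 2 * exp (r * real (Suc m)) * norm (sinh y)"
    using r0 by (intro add_mono mult_right_mono mult_left_mono) (auto simp: algebra_simps)
  also have "\<dots> = (2 * real (Suc m) + 1) * exp (r * real (Suc m)) * norm (sinh y)"
    by (simp add: algebra_simps)
  finally show ?case .
qed

lemma norm_sinh_squared: "(norm (sinh z))\<^sup>2 = (sinh (Re z))\<^sup>2 + (sin (Im z))\<^sup>2" for z :: complex
proof -
  have "(norm (sinh z))\<^sup>2 = (sinh (Re z) * cos (Im z))\<^sup>2 + (cosh (Re z) * sin (Im z))\<^sup>2"
    unfolding cmod_power2 sinh_field_def cosh_field_def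
    by (simp add: Re_exp Im_exp algebra_simps diff_divide_distrib add_divide_distrib)
  also have "\<dots> = (sinh (Re z))\<^sup>2 * ((cos (Im z))\<^sup>2 + (sin (Im z))\<^sup>2) + (sin (Im z))\<^sup>2"
    unfolding power_mult_distrib cosh_square_eq by algebra
  finally show ?thesis by simp
qed

lemma abs_le_abs_sinh: "\<bar>x\<bar> \<le> \<bar>sinh x\<bar>" for x :: real
proof -
  have *: "x \<le> sinh x" if "x \<ge> 0" for x :: real
  proof -
    have "sinh 0 - 0 \<le> sinh x - x"
      by (rule DERIV_nonneg_imp_nondecreasing[OF that])
         (auto intro!: derivative_eq_intros exI simp: cosh_real_ge_1)
    then show ?thesis by simp
  qed
  show ?thesis
    using *[of x] *[of "- x"] by (cases "x \<ge> 0") auto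
qed

text \<open>For x \<ge> 0, y cos y \<le> sin y at y = x/2 gives sin x = 2 sin(x/2) cos(x/2) \<ge> x
  cos(x/2)^2 = x (1 + cos x) / 2 \<ge> x/2.\<close>

lemma half_abs_le_abs_sin:
  fixes x :: real
  assumes "\<bar>x\<bar> \<le> pi / 2"
  shows "\<bar>x\<bar> / 2 \<le> \<bar>sin x\<bar>"
proof -
  have aux: "y * cos y \<le> sin y" if "0 \<le> y" "y \<le> pi" for y :: real
  proof -
    have "sin 0 - 0 * cos 0 \<le> sin y - y * cos y"
    proof (rule DERIV_nonneg_imp_nondecreasing[OF that(1)])
      fix x assume "0 \<le> x" "x \<le> y"
      then have "0 \<le> x * sin x" using that by (intro mult_nonneg_nonneg sin_ge_zero) auto
      moreover have "((\<lambda>x. sin x - x * cos x) has_real_derivative x * sin x) (at x)"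
        by (auto intro!: derivative_eq_intros)
      ultimately show "\<exists>d. ((\<lambda>x. sin x - x * cos x) has_real_derivative d) (at x) \<and> 0 \<le> d"
        by blast
    qed
    then show ?thesis by simp
  qed
  have *: "x / 2 \<le> sin x" if "0 \<le> x" "x \<le> pi / 2" for x :: real
  proof -
    have c: "0 \<le> cos x" "0 \<le> cos (x / 2)"
      using that by (auto intro!: cos_ge_zero)
    have "cos x = 2 * (cos (x / 2))\<^sup>2 - 1"
      using cos_double_cos[of "x / 2"] by simp
    then have "x / 2 \<le> x * (cos (x / 2))\<^sup>2"
      using c that mult_left_mono[of 1 "1 + cos x" x] by simp
    also have "\<dots> = 2 * (x / 2 * cos (x / 2)) * cos (x / 2)"
      by (simp add: power2_eq_square)
    also have "\<dots> \<le> 2 * sin (x / 2) * cos (x / 2)"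
      using aux[of "x / 2"] c that by (intro mult_right_mono mult_left_mono) auto
    also have "\<dots> = sin x" using sin_double[of "x / 2"] by simp
    finally show ?thesis .
  qed
  show ?thesis
    using *[of x] *[of "- x"] assms by (cases "x \<ge> 0") auto
qed

text \<open>The real and imaginary parts contribute separately to |sinh y|^2, each with a linear
  lower bound. The restriction on \<open>Im y\<close> keeps y away from the zeros of sinh other than
  0.\<close>

lemma norm_sinh_ge:
  fixes y :: complex
  assumes "\<bar>Im y\<bar> \<le> pi / 2"
  shows "norm y / 2 \<le> norm (sinh y)"
proof -
  have "(norm y / 2)\<^sup>2 = (\<bar>Re y\<bar> / 2)\<^sup>2 + (\<bar>Im y\<bar> / 2)\<^sup>2"
    by (simp add: cmod_power2 power_divide)
  also have "\<dots> \<le> \<bar>sinh (Re y)\<bar>\<^sup>2 + \<bar>sin (Im y)\<bar>\<^sup>2"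
    using abs_le_abs_sinh[of "Re y"] half_abs_le_abs_sin[OF assms]
    by (intro add_mono power_mono) auto
  also have "\<dots> = (norm (sinh y))\<^sup>2" by (simp add: norm_sinh_squared)
  finally show ?thesis by (rule power2_le_imp_le) simp
qed

lemma norm_sinh_le: "norm (sinh y) \<le> norm y * exp \<bar>Re y\<bar>" for y :: complex
proof -
  have *: "norm (exp z - 1) \<le> norm z * exp \<bar>Re z\<bar>" for z :: complex
    using Taylor_exp[of z 0] by (simp add: mult.commute)
  have "sinh y = ((exp y - 1) - (exp (- y) - 1)) / 2"
    by (simp add: sinh_field_def)
  also have "norm \<dots> \<le> (norm (exp y - 1) + norm (exp (- y) - 1)) / 2"
    using norm_triangle_ineq4[of "exp y - 1" "exp (- y) - 1"] by (simp only: norm_divide) simp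
  also have "\<dots> \<le> norm y * exp \<bar>Re y\<bar>"
    using *[of y] *[of "- y"] by simp
  finally show ?thesis .
qed

section \<open>Size of the Zak transform of the Gaussian\<close>

definition zak_term :: "int \<Rightarrow> real \<times> real \<Rightarrow> complex" where
  "zak_term j = (\<lambda>(x, \<xi>). gaussian (x - of_int j) * exp (2 * pi * \<i> * of_int j * of_real \<xi>))"

definition zak_gaussian :: "real \<times> real \<Rightarrow> complex" where
  "zak_gaussian p = (\<Sum>\<^sub>\<infinity>j. zak_term j p)"

text \<open>A summable majorant of the Zak series, uniform over the square. The factor
  \<open>exp 10\<close> absorbs the 3\<pi> lost in (x - j)^2 \<ge> |j| - 3.\<close>

definition zak_bound :: "int \<Rightarrow> real" where
  "zak_bound j = 2 powr (1/4) * exp 10 * (1/12) ^ nat \<bar>j\<bar>"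

lemma norm_zak_term_le:
  assumes "fst p \<in> {0..1}"
  shows "norm (zak_term j p) \<le> zak_bound j"
proof -
  obtain x \<xi> where p: "p = (x, \<xi>)" by (cases p)
  have x: "0 \<le> x" "x \<le> 1" using assms p by auto
  have "norm (zak_term j p) = 2 powr (1/4) * exp (- pi * (x - of_int j)\<^sup>2)"
    by (simp add: zak_term_def p gaussian_def norm_mult)
  also have "exp (- pi * (x - of_int j)\<^sup>2) \<le> exp (10 + - pi * \<bar>of_int j\<bar>)"
  proof -
    have "\<bar>of_int j\<bar> - 1 \<le> \<bar>x - of_int j\<bar>" using x by linarith
    moreover have "2 * \<bar>x - of_int j\<bar> - 1 \<le> (x - of_int j)\<^sup>2"
      using zero_le_power2[of "\<bar>x - of_int j\<bar> - 1"] by (simp add: power2_diff)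
    moreover have "u - 3 \<le> w" if "u - 1 \<le> d" "2 * d - 1 \<le> w" "0 \<le> u" for u d w :: real
      using that by linarith
    ultimately have "\<bar>of_int j\<bar> - 3 \<le> (x - of_int j)\<^sup>2" by (meson abs_ge_zero)
    then have "pi * (\<bar>of_int j\<bar> - 3) \<le> pi * (x - of_int j)\<^sup>2" by (intro mult_left_mono) auto
    moreover have "3 * pi \<le> 10" using pi_approx by simp
    ultimately show ?thesis by (simp add: algebra_simps)
  qed
  also have "exp (10 + - pi * \<bar>of_int j\<bar>) = exp 10 * exp (- pi) ^ nat \<bar>j\<bar>"
    unfolding exp_add exp_of_nat2_mult [symmetric] by simp
  also have "exp 10 * exp (- pi) ^ nat \<bar>j\<bar> \<le> exp 10 * (1/12) ^ nat \<bar>j\<bar>"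
    by (intro mult_left_mono power_mono exp_minus_pi_le) auto
  finally show ?thesis by (simp add: zak_bound_def mult_ac)
qed

lemma zak_bound_summable: "zak_bound summable_on UNIV"
proof -
  have g: "(\<lambda>n. 2 powr (1/4) * exp 10 * (1/12) ^ n :: real) summable_on UNIV"
    by (intro summable_on_cmult_right norm_summable_imp_summable_on) simp
  have "zak_bound summable_on range int"
    by (subst summable_on_reindex) (use g in \<open>auto simp: o_def zak_bound_def\<close>)
  moreover have "zak_bound summable_on range (\<lambda>n. - int n)"
    by (subst summable_on_reindex) (use g in \<open>auto simp: o_def zak_bound_def inj_def\<close>)
  moreover have "range (\<lambda>n. - int n) - range int \<subseteq> range (\<lambda>n. - int n)" by auto
  ultimately have "zak_bound summable_on (range int \<union> (range (\<lambda>n. - int n) - range int))"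
    by (intro summable_on_Un_disjoint) (auto intro: summable_on_subset_banach)
  moreover have "range int \<union> (range (\<lambda>n. - int n) - range int) = (UNIV :: int set)"
    by (auto intro: int_cases2)
  ultimately show ?thesis by simp
qed

lemma has_sum_zak_gaussian:
  assumes "fst p \<in> {0..1}"
  shows "((\<lambda>j. zak_term j p) has_sum zak_gaussian p) UNIV"
proof -
  have "(\<lambda>j. zak_term j p) summable_on UNIV"
  proof (rule abs_summable_summable, rule Infinite_Sum.abs_summable_on_comparison_test')
    show "zak_bound summable_on UNIV" by (rule zak_bound_summable)
  qed (rule norm_zak_term_le[OF assms])
  then show ?thesis unfolding zak_gaussian_def by (rule has_sum_infsum)
qed

text \<open>Expanding the squares around 1/2, both exponents have the same part even in y and
  opposite odd parts \<plusminus>(2m+1)y. The phases at \<xi> = 1/2 are -(-1)^m and (-1)^m, so the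
  exponentials combine to a sinh. As s is arbitrary, the formula also applies at 1/2 + k for
  integers k.\<close>

lemma zak_gaussian_pair:
  fixes s \<eta> :: real
  defines "y \<equiv> of_real pi * Complex s \<eta>"
  shows "zak_term (int m + 1) (1/2 + s, 1/2 + \<eta>) + zak_term (- int m) (1/2 + s, 1/2 + \<eta>)
    = - 2 * of_real (2 powr (1/4)) * exp (- pi * s\<^sup>2 + \<i> * pi * \<eta>)
        * ((-1) ^ m * of_real (gauss_coeff m) * sinh (of_nat (2 * m + 1) * y))"
proof -
  let ?K = "of_real (2 powr (1/4)) * exp (- pi * s\<^sup>2 + \<i> * pi * \<eta>) * of_real (gauss_coeff m)"
  have c: "exp (\<i> * pi * of_nat m) = (-1) ^ m" for m
  proof -
    have "exp (\<i> * pi * of_nat m) = exp (\<i> * pi) ^ m"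
      by (simp only: exp_of_nat2_mult)
    then show ?thesis by (simp add: exp_pi_i')
  qed
  have y: "y = pi * s + \<i> * pi * \<eta>"
    by (simp add: y_def complex_eq_iff)
  have "zak_term (int m + 1) (1/2 + s, 1/2 + \<eta>)
      = of_real (2 powr (1/4)) * exp (- pi * s\<^sup>2 + \<i> * pi * \<eta> + - pi * (m + 1/2)\<^sup>2
           + \<i> * pi * of_nat (Suc m) + of_nat (2 * m + 1) * y)"
    unfolding zak_term_def gaussian_def prod.case of_real_mult exp_of_real [symmetric] mult.assoc exp_add [symmetric]
    by (rule arg_cong[of _ _ "\<lambda>z. of_real (2 powr (1/4)) * exp z"])
       (simp add: y power2_eq_square field_simps)
  also have "\<dots> = ?K * (- ((-1) ^ m)) * exp (of_nat (2 * m + 1) * y)"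
    unfolding exp_add c gauss_coeff_def exp_of_real [symmetric] by simp
  finally have 1: "zak_term (int m + 1) (1/2 + s, 1/2 + \<eta>) = ?K * (- ((-1) ^ m)) * exp (of_nat (2 * m + 1) * y)" .
  have c': "exp (- (\<i> * pi * of_nat m)) = (-1) ^ m" for m
    by (simp add: exp_minus c power_minus_even flip: power_inverse)
  have "zak_term (- int m) (1/2 + s, 1/2 + \<eta>)
      = of_real (2 powr (1/4)) * exp (- pi * s\<^sup>2 + \<i> * pi * \<eta> + - pi * (m + 1/2)\<^sup>2
           + - (\<i> * pi * of_nat m) + - (of_nat (2 * m + 1) * y))"
    unfolding zak_term_def gaussian_def prod.case of_real_mult exp_of_real [symmetric] mult.assoc exp_add [symmetric]
    by (rule arg_cong[of _ _ "\<lambda>z. of_real (2 powr (1/4)) * exp z"])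
       (simp add: y power2_eq_square field_simps)
  also have "\<dots> = ?K * (-1) ^ m * exp (- (of_nat (2 * m + 1) * y))"
    unfolding exp_add c' gauss_coeff_def exp_of_real [symmetric] by simp
  finally have 2: "zak_term (- int m) (1/2 + s, 1/2 + \<eta>) = ?K * (-1) ^ m * exp (- (of_nat (2 * m + 1) * y))" .
  show ?thesis unfolding 1 2 sinh_field_def by (simp add: algebra_simps)
qed

text \<open>The paired series differs from its first term by at most a third of it, and that term is
  a multiple of sinh y, which is comparable to |y| = \<pi> \<rho> because both parts of y are at
  most \<pi>/2 in modulus.\<close>

lemma zak_gaussian_bounds:
  obtains c C where "c > 0" "C > 0"
    "\<And>p. p \<in> unit_square \<Longrightarrow> c * rho (1/2) (1/2) p \<le> norm (zak_gaussian p)"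
    "\<And>p. p \<in> unit_square \<Longrightarrow> norm (zak_gaussian p) \<le> C * rho (1/2) (1/2) p"
proof -
  define A where "A = 2 * 2 powr (1/4) * gauss_coeff 0"
  have A: "A > 0" by (simp add: A_def gauss_coeff_pos)
  have main: "A * (2/3) * exp (- pi / 4) * (pi * rho (1/2) (1/2) p / 2) \<le> norm (zak_gaussian p) \<and>
      norm (zak_gaussian p) \<le> A * (4/3) * (pi * rho (1/2) (1/2) p * exp (pi / 2))"
    if p: "p \<in> unit_square" for p
  proof -
    define s \<eta> where "s = fst p - 1/2" and "\<eta> = snd p - 1/2"
    have bnd: "\<bar>s\<bar> \<le> 1/2" "\<bar>\<eta>\<bar> \<le> 1/2"
      using p by (auto simp: unit_square_def s_def \<eta>_def abs_if)
    have p_eq: "p = (1/2 + s, 1/2 + \<eta>)" by (simp add: s_def \<eta>_def)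
    define y where "y = of_real pi * Complex s \<eta>"
    have rho: "norm y = pi * rho (1/2) (1/2) p"
      by (simp add: y_def p_eq rho_def norm_mult cmod_def power_mult_distrib real_sqrt_mult flip: distrib_left)
    have Re: "\<bar>Re y\<bar> \<le> pi / 2" and Im: "\<bar>Im y\<bar> \<le> pi / 2"
      using bnd by (auto simp: y_def abs_mult)
    define K where "K = - 2 * of_real (2 powr (1/4)) * exp (- pi * s\<^sup>2 + \<i> * pi * \<eta>)"
    define f where "f m = (-1) ^ m * of_real (gauss_coeff m) * sinh (of_nat (2 * m + 1) * y)" for m
    have fb: "norm (f (Suc m)) \<le> gauss_coeff 0 * norm (sinh y) * (1/4) ^ Suc m" for m
    proof -
      have "norm (f (Suc m)) = gauss_coeff (Suc m) * norm (sinh (of_nat (2 * Suc m + 1) * y))"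
        using gauss_coeff_pos[of "Suc m"] by (simp add: f_def norm_mult norm_power)
      also have "\<dots> \<le> gauss_coeff (Suc m) * ((2 * real (Suc m) + 1) * exp (pi * real (Suc m)) * norm (sinh y))"
        using Re gauss_coeff_pos[of "Suc m"] by (intro mult_left_mono norm_sinh_odd_multiple_le) auto
      also have "\<dots> \<le> gauss_coeff 0 * (1/4) ^ Suc m * norm (sinh y)"
        using mult_right_mono[OF gauss_coeff_decay[of m], of "norm (sinh y)"] by (simp add: mult_ac)
      finally show ?thesis by (simp add: mult_ac)
    qed
    note f = norm_suminf_minus_head_le[OF fb]
    have "((\<lambda>j. zak_term j p) has_sum zak_gaussian p) UNIV"
      by (rule has_sum_zak_gaussian) (use p in \<open>auto simp: unit_square_def\<close>)
    \<comment> \<open>The shift by one turns the pairs m, -1-m of \<open>sums_pair_int\<close> into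
      the pairs m+1, -m, which are symmetric about 1/2.\<close>
    then have "((\<lambda>j. zak_term (j + 1) p) has_sum zak_gaussian p) UNIV"
      by (subst has_sum_reindex_bij_witness[where i = "\<lambda>j. j - 1" and j = "\<lambda>j. j + 1" and T = UNIV and h = "\<lambda>j. zak_term j p"]) auto
    from sums_pair_int[OF this] have "(\<lambda>m. K * f m) sums zak_gaussian p"
      using zak_gaussian_pair[of _ s \<eta>] by (simp add: p_eq K_def f_def y_def algebra_simps)
    then have Z: "zak_gaussian p = K * suminf f"
      using sums_unique2 sums_mult[OF summable_sums[OF f(1)]] by blast
    have f0: "norm (f 0) = gauss_coeff 0 * norm (sinh y)"
      using gauss_coeff_pos[of 0] by (simp add: f_def norm_mult)
    have lo: "gauss_coeff 0 * norm (sinh y) * (2/3) \<le> norm (suminf f)"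
      using f(2) f0 norm_triangle_ineq2[of "f 0" "suminf f"] norm_minus_commute[of "f 0" "suminf f"] by simp
    have hi: "norm (suminf f) \<le> gauss_coeff 0 * norm (sinh y) * (4/3)"
      using f(2) f0 norm_triangle_ineq2[of "suminf f" "f 0"] by simp
    have K: "norm K = 2 * 2 powr (1/4) * exp (- pi * s\<^sup>2)"
      by (simp add: K_def norm_mult)
    have s2: "s\<^sup>2 \<le> 1/4"
      using bnd power_mono[of "\<bar>s\<bar>" "1/2" 2] by (simp add: power2_eq_square)
    have e: "exp (- pi / 4) \<le> exp (- pi * s\<^sup>2)" "exp (- pi * s\<^sup>2) \<le> 1"
      using s2 by auto
    have "A * (2/3) * exp (- pi / 4) * (norm y / 2) \<le> A * (2/3) * exp (- pi * s\<^sup>2) * norm (sinh y)"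
      using A e norm_sinh_ge[OF Im] by (intro mult_mono) auto
    also have "\<dots> = norm K * (gauss_coeff 0 * norm (sinh y) * (2/3))"
      by (simp add: A_def K)
    also have "\<dots> \<le> norm (zak_gaussian p)"
      unfolding Z norm_mult by (intro mult_left_mono lo) auto
    finally have L: "A * (2/3) * exp (- pi / 4) * (norm y / 2) \<le> norm (zak_gaussian p)" .
    have "norm (zak_gaussian p) \<le> norm K * (gauss_coeff 0 * norm (sinh y) * (4/3))"
      unfolding Z norm_mult by (intro mult_left_mono hi) auto
    also have "\<dots> = A * (4/3) * exp (- pi * s\<^sup>2) * norm (sinh y)"
      by (simp add: A_def K)
    also have "\<dots> \<le> A * (4/3) * 1 * (norm y * exp \<bar>Re y\<bar>)"
      using A e norm_sinh_le[of y] by (intro mult_mono) auto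
    also have "\<dots> \<le> A * (4/3) * 1 * (norm y * exp (pi / 2))"
      using A Re by (intro mult_left_mono) auto
    finally have "norm (zak_gaussian p) \<le> A * (4/3) * (norm y * exp (pi / 2))" by simp
    with L show ?thesis unfolding rho by simp
  qed
  show ?thesis
    by (rule that[of "A * (2/3) * exp (- pi / 4) * pi / 2" "A * (4/3) * pi * exp (pi / 2)"])
       (use A main in \<open>auto simp: mult_ac\<close>)
qed

section \<open>Integrability on the unit square\<close>

lemma L2_diff:
  assumes "f \<in> L2 M" "g \<in> L2 M"
  shows "(\<lambda>x. f x - g x) \<in> L2 M"
    and "(LINT x|M. (norm (f x - g x))\<^sup>2) \<le> 2 * (LINT x|M. (norm (f x))\<^sup>2) + 2 * (LINT x|M. (norm (g x))\<^sup>2)"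
proof -
  have [measurable]: "f \<in> borel_measurable M" "g \<in> borel_measurable M"
    and int: "integrable M (\<lambda>x. (norm (f x))\<^sup>2)" "integrable M (\<lambda>x. (norm (g x))\<^sup>2)"
    using assms by (auto simp: L2_def)
  have le: "(norm (f x - g x))\<^sup>2 \<le> 2 * (norm (f x))\<^sup>2 + 2 * (norm (g x))\<^sup>2" for x
  proof -
    have "(norm (f x - g x))\<^sup>2 \<le> (norm (f x) + norm (g x))\<^sup>2"
      by (intro power_mono norm_triangle_ineq4) simp
    also have "\<dots> \<le> 2 * (norm (f x))\<^sup>2 + 2 * (norm (g x))\<^sup>2"
      using sum_squares_bound[of "norm (f x)" "norm (g x)"] by (simp add: power2_sum)
    finally show ?thesis .
  qed
  have i: "integrable M (\<lambda>x. 2 * (norm (f x))\<^sup>2 + 2 * (norm (g x))\<^sup>2)"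
    using int by simp
  have d: "integrable M (\<lambda>x. (norm (f x - g x))\<^sup>2)"
    by (rule Bochner_Integration.integrable_bound[OF i]) (use le in auto)
  then show "(\<lambda>x. f x - g x) \<in> L2 M" by (simp add: L2_def)
  have "(LINT x|M. (norm (f x - g x))\<^sup>2) \<le> (LINT x|M. 2 * (norm (f x))\<^sup>2 + 2 * (norm (g x))\<^sup>2)"
    by (rule integral_mono[OF d i le])
  also have "\<dots> = 2 * (LINT x|M. (norm (f x))\<^sup>2) + 2 * (LINT x|M. (norm (g x))\<^sup>2)"
    using int by simp
  finally show "(LINT x|M. (norm (f x - g x))\<^sup>2) \<le> \<dots>" .
qed

lemma (in finite_measure) L2_bounded:
  assumes "f \<in> borel_measurable M" "AE x in M. norm (f x) \<le> B"
  shows "f \<in> L2 M"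
  unfolding L2_def
proof (intro CollectI conjI integrable_const_bound)
  show "AE x in M. norm ((norm (f x))\<^sup>2) \<le> B\<^sup>2"
    using assms(2) by eventually_elim (auto intro!: power_mono)
qed (use assms in auto)

text \<open>This identifies the representative chosen by \<open>Zak\<close> with the pointwise sum,
  up to a null set.\<close>

lemma L2_limit_unique:
  assumes "eventually (\<lambda>A. s A \<in> L2 M) F" "F \<noteq> bot" "f \<in> L2 M" "g \<in> L2 M"
    and "((\<lambda>A. L2_norm M (\<lambda>x. s A x - f x)) \<longlongrightarrow> 0) F"
    and "((\<lambda>A. L2_norm M (\<lambda>x. s A x - g x)) \<longlongrightarrow> 0) F"
  shows "AE x in M. f x = g x"
proof -
  let ?I = "LINT x|M. (norm (f x - g x))\<^sup>2"
  have "((\<lambda>A. 2 * (L2_norm M (\<lambda>x. s A x - g x))\<^sup>2 + 2 * (L2_norm M (\<lambda>x. s A x - f x))\<^sup>2) \<longlongrightarrow> 2 * 0\<^sup>2 + 2 * 0\<^sup>2) F"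
    by (intro tendsto_intros assms)
  moreover have "\<forall>\<^sub>F A in F. ?I \<le> 2 * (L2_norm M (\<lambda>x. s A x - g x))\<^sup>2 + 2 * (L2_norm M (\<lambda>x. s A x - f x))\<^sup>2"
    using assms(1)
  proof eventually_elim
    case (elim A)
    show ?case
      using L2_diff(2)[OF L2_diff(1)[OF elim assms(4)] L2_diff(1)[OF elim assms(3)]]
      by (simp add: L2_norm_def)
  qed
  ultimately have "?I \<le> 0"
    using tendsto_lowerbound assms(2) by fastforce
  then have "?I = 0" by (simp add: order_antisym)
  moreover have "integrable M (\<lambda>x. (norm (f x - g x))\<^sup>2)"
    using L2_diff(1)[OF assms(3,4)] by (simp add: L2_def)
  ultimately have "AE x in M. (norm (f x - g x))\<^sup>2 = 0"
    by (subst (asm) integral_nonneg_eq_0_iff_AE) auto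
  then show ?thesis by simp
qed

text \<open>The step function with values \<open>c i\<close> on \<open>A i\<close> lies below h, so
  its partial integrals are bounded. The contrapositive is the test for non-integrability, applied
  to 1 / \<rho>^2 and later to the dual window.\<close>

lemma summable_integrable_disjoint:
  fixes h :: "'a \<Rightarrow> real"
  assumes h: "integrable M h" "\<And>x. 0 \<le> h x"
    and A: "disjoint_family A" "\<And>i. A i \<in> sets M" "\<And>i. emeasure M (A i) < \<infinity>"
    and c: "\<And>i. 0 \<le> c i" "\<And>i x. x \<in> A i \<Longrightarrow> c i \<le> h x"
  shows "summable (\<lambda>i::nat. c i * measure M (A i))"
proof (rule summableI_nonneg_bounded)
  fix N
  have i: "integrable M (\<lambda>x. \<Sum>i<N. c i * indicator (A i) x)"
    using A by (intro Bochner_Integration.integrable_sum integrable_mult_right integrable_real_indicator)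
  have le: "(\<Sum>i<N. c i * indicator (A i) x) \<le> h x" for x
  proof (cases "\<exists>k<N. x \<in> A k")
    case True
    then obtain k where k: "k < N" "x \<in> A k" by auto
    have "indicator (A i) x = (if i = k then 1 else 0 :: real)" for i
      using k A(1) by (auto simp: disjoint_family_on_def indicator_def)
    then have "(\<Sum>i<N. c i * indicator (A i) x) = c k"
      using k by (simp add: if_distrib[of "(*) _"] cong: if_cong)
    then show ?thesis using c(2)[OF k(2)] by simp
  next
    case False
    then have "(\<Sum>i<N. c i * indicator (A i) x) = 0"
      by (intro sum.neutral) (auto simp: indicator_def)
    then show ?thesis using h by simp
  qed
  have "(\<Sum>i<N. c i * measure M (A i)) = (LINT x|M. (\<Sum>i<N. c i * indicator (A i) x))"
    using A by (subst Bochner_Integration.integral_sum) (auto intro!: integrable_mult_right integrable_real_indicator)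
  also have "\<dots> \<le> integral\<^sup>L M h"
    by (rule integral_mono[OF i h(1) le])
  finally show "(\<Sum>i<N. c i * measure M (A i)) \<le> integral\<^sup>L M h" .
qed (use c in simp)

section \<open>Lebesgue measure on the unit square\<close>

lemma unit_square_sets [measurable]: "unit_square \<in> sets borel"
  unfolding unit_square_def by (intro borel_Times) auto

lemma measure_lborel_rectangle:
  assumes "a \<le> b" "c \<le> d"
  shows "emeasure lborel ({a..<b} \<times> {c..<d} :: (real \<times> real) set) = ennreal ((b - a) * (d - c))"
proof -
  have "emeasure lborel ({a..<b} \<times> {c..<d}) = emeasure (lborel \<Otimes>\<^sub>M lborel) ({a..<b} \<times> {c..<d})"
    by (simp add: lborel_prod)
  also have "\<dots> = emeasure lborel {a..<b} * emeasure lborel {c..<d}"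
    by (intro lborel.emeasure_pair_measure_Times) auto
  finally show ?thesis using assms by (simp add: ennreal_mult)
qed

lemma space_square [simp]: "space square_measure = unit_square"
  by (simp add: space_restrict_space)

lemma emeasure_square: "A \<subseteq> unit_square \<Longrightarrow> emeasure square_measure A = emeasure lborel A"
  by (rule emeasure_restrict_space) simp_all

lemma prob_square: "emeasure square_measure unit_square = 1"
  using measure_lborel_rectangle[of 0 1 0 1] by (simp add: emeasure_square) (simp add: unit_square_def)

interpretation square: finite_measure square_measure
  by (rule finite_measureI) (simp only: space_square prob_square, simp)

lemma L2_norm_square_le:
  assumes "\<And>p. p \<in> unit_square \<Longrightarrow> norm (f p) \<le> B"
  shows "L2_norm square_measure f \<le> B"
proof -
  have "(0, 0) \<in> unit_square" by (simp add: unit_square_def)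
  then have B: "B \<ge> 0" using assms norm_ge_zero order_trans by blast
  have "(LINT p|square_measure. (norm (f p))\<^sup>2) \<le> (LINT p|square_measure. B\<^sup>2)"
  proof (rule integral_mono')
    show "integrable square_measure (\<lambda>p. B\<^sup>2)" by simp
  qed (auto intro!: power_mono assms)
  also have "\<dots> = B\<^sup>2"
    by (simp add: measure_def prob_square)
  finally show ?thesis
    using B by (simp add: L2_norm_def real_le_lsqrt)
qed

lemma borel_measurable_square_continuous:
  assumes "continuous_on UNIV f"
  shows "f \<in> borel_measurable square_measure"
  by (rule measurable_restrict_space1) (use borel_measurable_continuous_onI[OF assms] in simp)

lemma zak_term_measurable [measurable]: "zak_term j \<in> borel_measurable square_measure"
  by (rule borel_measurable_square_continuous)
     (auto simp: zak_term_def gaussian_def case_prod_beta intro!: continuous_intros)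

lemma zak_gaussian_measurable [measurable]: "zak_gaussian \<in> borel_measurable square_measure"
proof (rule borel_measurable_LIMSEQ_metric)
  show "(\<lambda>p. \<Sum>m<N. zak_term (int m) p + zak_term (- 1 - int m) p) \<in> borel_measurable square_measure" for N
    by measurable
  show "(\<lambda>N. \<Sum>m<N. zak_term (int m) p + zak_term (- 1 - int m) p) \<longlonglongrightarrow> zak_gaussian p"
    if "p \<in> space square_measure" for p
  proof -
    have "fst p \<in> {0..1}" using that unfolding space_square by (auto simp: unit_square_def)
    then show ?thesis using sums_pair_int[OF has_sum_zak_gaussian] by (simp add: sums_def)
  qed
qed

lemma rho_pos: "p \<noteq> (a, b) \<Longrightarrow> rho a b p > 0"
  by (cases p) (auto simp: rho_def sum_power2_gt_zero_iff)

lemma rho_measurable [measurable]: "rho a b \<in> borel_measurable square_measure"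
  by (rule borel_measurable_square_continuous)
     (auto simp: rho_def case_prod_beta intro!: continuous_intros)

lemma rho_half_le: "p \<in> unit_square \<Longrightarrow> rho (1/2) (1/2) p \<le> 1"
proof -
  assume "p \<in> unit_square"
  then obtain x y where p: "p = (x, y)" and xy: "\<bar>x - 1/2\<bar> \<le> 1/2" "\<bar>y - 1/2\<bar> \<le> 1/2"
    by (cases p) (auto simp: unit_square_def abs_if)
  have "(x - 1/2)\<^sup>2 \<le> (1/2)\<^sup>2" "(y - 1/2)\<^sup>2 \<le> (1/2)\<^sup>2"
    using xy by (simp_all only: abs_le_square_iff [symmetric])
  then show ?thesis by (simp add: p rho_def power2_eq_square)
qed

lemma has_zak_transform_gaussian_iff:
  "has_zak_transform gaussian F \<longleftrightarrow> F \<in> L2 square_measure \<and>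
    ((\<lambda>A. L2_norm square_measure (\<lambda>p. (\<Sum>j\<in>A. zak_term j p) - F p)) \<longlongrightarrow> 0)
      (finite_subsets_at_top UNIV)"
  by (simp add: has_zak_transform_def zak_term_def case_prod_unfold)

text \<open>The majorant \<open>zak_bound\<close> gives uniform convergence along finite index sets.
  The square has measure one, so a uniform bound is an L2 bound.\<close>

lemma has_zak_transform_gaussian: "has_zak_transform gaussian zak_gaussian"
proof -
  obtain C where C: "\<And>p. p \<in> unit_square \<Longrightarrow> norm (zak_gaussian p) \<le> C * rho (1/2) (1/2) p" "C > 0"
    using zak_gaussian_bounds by metis
  have "zak_gaussian \<in> L2 square_measure"
  proof (rule square.L2_bounded)
    show "AE p in square_measure. norm (zak_gaussian p) \<le> C"
    proof (rule AE_I2)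
      fix p assume "p \<in> space square_measure"
      then show "norm (zak_gaussian p) \<le> C"
        using order_trans[OF C(1)[of p] mult_left_mono[OF rho_half_le[of p], of C]] C(2) by simp
    qed
  qed simp
  moreover have "uniform_limit unit_square (\<lambda>A p. \<Sum>j\<in>A. zak_term j p) zak_gaussian (finite_subsets_at_top UNIV)"
    by (rule Weierstrass_m_test_general'[OF norm_zak_term_le has_sum_zak_gaussian zak_bound_summable])
       (auto simp: unit_square_def)
  then have "((\<lambda>A. L2_norm square_measure (\<lambda>p. (\<Sum>j\<in>A. zak_term j p) - zak_gaussian p)) \<longlongrightarrow> 0)
      (finite_subsets_at_top UNIV)"
    unfolding tendsto_iff uniform_limit_iff
  proof (intro allI impI)
    fix e :: real
    assume *: "\<forall>e>0. \<forall>\<^sub>F A in finite_subsets_at_top UNIV. \<forall>p\<in>unit_square. dist (\<Sum>j\<in>A. zak_term j p) (zak_gaussian p) < e"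
      and "e > 0"
    then have "\<forall>\<^sub>F A in finite_subsets_at_top UNIV. \<forall>p\<in>unit_square. dist (\<Sum>j\<in>A. zak_term j p) (zak_gaussian p) < e / 2"
      using half_gt_zero by blast
    then show "\<forall>\<^sub>F A in finite_subsets_at_top UNIV.
        dist (L2_norm square_measure (\<lambda>p. (\<Sum>j\<in>A. zak_term j p) - zak_gaussian p)) 0 < e"
    proof eventually_elim
      case (elim A)
      then have "L2_norm square_measure (\<lambda>p. (\<Sum>j\<in>A. zak_term j p) - zak_gaussian p) \<le> e / 2"
        by (intro L2_norm_square_le) (auto simp: dist_norm intro: less_imp_le)
      moreover have "0 \<le> L2_norm square_measure (\<lambda>p. (\<Sum>j\<in>A. zak_term j p) - zak_gaussian p)"
        by (simp add: L2_norm_def)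
      ultimately show ?case using \<open>e > 0\<close> by simp
    qed
  qed
  ultimately show ?thesis
    by (simp add: has_zak_transform_gaussian_iff)
qed

lemma Zak_gaussian_AE: "Zak gaussian \<in> L2 square_measure" "AE p in square_measure. Zak gaussian p = zak_gaussian p"
proof -
  have *: "has_zak_transform gaussian (Zak gaussian)"
    unfolding Zak_def by (rule someI[of "has_zak_transform gaussian", OF has_zak_transform_gaussian])
  show "AE p in square_measure. Zak gaussian p = zak_gaussian p"
  proof (rule L2_limit_unique)
    show "\<forall>\<^sub>F A in finite_subsets_at_top UNIV. (\<lambda>p. \<Sum>j\<in>A. zak_term j p) \<in> L2 square_measure"
    proof (rule always_eventually, rule allI)
      fix A
      have "norm (\<Sum>j\<in>A. zak_term j p) \<le> (\<Sum>j\<in>A. zak_bound j)" if "p \<in> unit_square" for p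
        using that by (intro order_trans[OF norm_sum] sum_mono norm_zak_term_le) (auto simp: unit_square_def)
      then show "(\<lambda>p. \<Sum>j\<in>A. zak_term j p) \<in> L2 square_measure"
        by (intro square.L2_bounded[where B = "\<Sum>j\<in>A. zak_bound j"]) auto
    qed
  qed (use * has_zak_transform_gaussian in \<open>simp_all add: has_zak_transform_gaussian_iff\<close>)
  show "Zak gaussian \<in> L2 square_measure"
    using * by (simp add: has_zak_transform_def)
qed

lemma AE_square_neq: "AE p in square_measure. p \<noteq> q"
proof (rule AE_I')
  show "{q} \<inter> unit_square \<in> null_sets square_measure"
    by (subst null_sets_restrict_space) (auto intro!: null_setsI finite_imp_null_set_lborel)
qed auto

lemma rho_inverse_square_not_integrable:
  "\<not> integrable square_measure (\<lambda>p. 1 / (rho (1/2) (1/2) p)\<^sup>2)"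
proof
  assume int: "integrable square_measure (\<lambda>p. 1 / (rho (1/2) (1/2) p)\<^sup>2)"
  define d :: "nat \<Rightarrow> real" where "d n = (1/2) ^ Suc n" for n
  txt \<open>Disjoint rectangles approaching the singularity dyadically, each contributing at least \<open>1/4\<close> to the integral.\<close>
  define A where "A n = {1/2 + d n / 2..<1/2 + d n} \<times> {1/2..<1/2 + d n}" for n
  have d: "0 < d n" "d n \<le> 1/2" for n
    by (auto simp: d_def power_le_one mult_le_one)
  have d_mono: "d n \<le> d m / 2" if "m < n" for m n
    using power_decreasing[of "Suc m" n "1/2::real"] that by (simp add: d_def)
  have Asub: "A n \<subseteq> unit_square" for n
    using d[of n] by (auto simp: A_def unit_square_def)
  have emA: "emeasure square_measure (A n) = ennreal ((d n)\<^sup>2 / 2)" for n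
    using measure_lborel_rectangle[of "1/2 + d n / 2" "1/2 + d n" "1/2" "1/2 + d n"] d[of n] Asub[of n]
    by (simp add: emeasure_square) (simp add: A_def power2_eq_square)
  have "summable (\<lambda>n. 1 / (2 * (d n)\<^sup>2) * measure square_measure (A n))"
  proof (rule summable_integrable_disjoint[OF int])
    have "A m \<inter> A n = {}" if "m < n" for m n
      using d_mono[OF that] by (auto simp: A_def)
    then show "disjoint_family A"
      unfolding disjoint_family_on_def by (metis inf_commute linorder_neqE_nat)
    show "A n \<in> sets square_measure" for n
    proof -
      have "A n \<in> sets borel" unfolding A_def by (intro borel_Times) auto
      then show ?thesis using Asub[of n] by (simp add: sets_restrict_space_iff)
    qed
    show "emeasure square_measure (A n) < \<infinity>" for n
      by (simp add: emA)
    show "1 / (2 * (d n)\<^sup>2) \<le> 1 / (rho (1/2) (1/2) p)\<^sup>2" if "p \<in> A n" for n p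
    proof -
      obtain x y where p: "p = (x, y)" by (cases p)
      have "0 < x - 1/2" "x - 1/2 \<le> d n" "0 \<le> y - 1/2" "y - 1/2 \<le> d n"
        using that d[of n] by (auto simp: A_def p)
      then have "(x - 1/2)\<^sup>2 + (y - 1/2)\<^sup>2 \<le> 2 * (d n)\<^sup>2" "0 < (x - 1/2)\<^sup>2 + (y - 1/2)\<^sup>2"
        using add_mono[OF power_mono[of "x - 1/2" "d n" 2] power_mono[of "y - 1/2" "d n" 2]]
        by (simp_all add: sum_power2_gt_zero_iff)
      then show ?thesis
        by (simp add: p rho_def frac_le)
    qed
  qed auto
  moreover have "1 / (2 * (d n)\<^sup>2) * measure square_measure (A n) = 1/4" for n
    using d[of n] by (simp add: measure_def emA)
  ultimately show False by (simp only: summable_const_iff)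
qed

text \<open>All three follow from c \<rho> \<le> |\<Theta>| \<le> C \<rho> almost everywhere: the
  upper bound makes 1 / |\<Theta>|^2 dominate a multiple of 1 / \<rho>^2, the lower one bounds
  \<rho> / |\<Theta>|.\<close>

lemma Zak_gaussian_properties:
  "AE p in square_measure. Zak gaussian p \<noteq> 0"
  "(\<lambda>p. 1 / Zak gaussian p) \<notin> L2 square_measure"
  "(\<lambda>p. complex_of_real (rho (1/2) (1/2) p) / Zak gaussian p) \<in> L2 square_measure"
proof -
  obtain c C where cC: "c > 0" "C > 0"
    and lo: "\<And>p. p \<in> unit_square \<Longrightarrow> c * rho (1/2) (1/2) p \<le> norm (zak_gaussian p)"
    and hi: "\<And>p. p \<in> unit_square \<Longrightarrow> norm (zak_gaussian p) \<le> C * rho (1/2) (1/2) p"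
    by (rule zak_gaussian_bounds) blast
  have [measurable]: "Zak gaussian \<in> borel_measurable square_measure"
    using Zak_gaussian_AE(1) by (simp add: L2_def)
  have AE_lo: "AE p in square_measure. 0 < rho (1/2) (1/2) p \<and>
      c * rho (1/2) (1/2) p \<le> norm (Zak gaussian p) \<and> norm (Zak gaussian p) \<le> C * rho (1/2) (1/2) p"
    using Zak_gaussian_AE(2) AE_square_neq[of "(1/2, 1/2)"] AE_space
    by eventually_elim (auto simp: lo hi rho_pos)
  then show "AE p in square_measure. Zak gaussian p \<noteq> 0"
    by eventually_elim (use cC in \<open>smt (verit) mult_pos_pos norm_zero\<close>)
  show "(\<lambda>p. 1 / Zak gaussian p) \<notin> L2 square_measure"
  proof
    assume "(\<lambda>p. 1 / Zak gaussian p) \<in> L2 square_measure"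
    then have "integrable square_measure (\<lambda>p. C\<^sup>2 * (norm (1 / Zak gaussian p))\<^sup>2)"
      by (simp add: L2_def)
    then have "integrable square_measure (\<lambda>p. 1 / (rho (1/2) (1/2) p)\<^sup>2)"
    proof (rule Bochner_Integration.integrable_bound)
      show "AE p in square_measure. norm (1 / (rho (1/2) (1/2) p)\<^sup>2) \<le> norm (C\<^sup>2 * (norm (1 / Zak gaussian p))\<^sup>2)"
        using AE_lo
      proof eventually_elim
        case (elim p)
        let ?z = "norm (Zak gaussian p)" and ?r = "rho (1/2) (1/2) p"
        have z: "?z > 0" using elim cC by (smt (verit) mult_pos_pos)
        then have "?z\<^sup>2 \<le> (C * ?r)\<^sup>2" using elim by (intro power_mono) auto
        then have "1 / ?r\<^sup>2 \<le> C\<^sup>2 / ?z\<^sup>2"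
          using z elim by (simp add: power_mult_distrib field_simps)
        then show ?case by (simp add: norm_divide power_divide)
      qed
    qed simp
    then show False using rho_inverse_square_not_integrable by simp
  qed
  show "(\<lambda>p. complex_of_real (rho (1/2) (1/2) p) / Zak gaussian p) \<in> L2 square_measure"
  proof (rule square.L2_bounded[where B = "1 / c"])
    show "AE p in square_measure. norm (complex_of_real (rho (1/2) (1/2) p) / Zak gaussian p) \<le> 1 / c"
      using AE_lo
    proof eventually_elim
      case (elim p)
      then have "norm (Zak gaussian p) > 0" using cC by (smt (verit) mult_pos_pos)
      then show ?case using elim cC by (simp add: norm_divide field_simps)
    qed
  qed measurable
qed

section \<open>Bastiaans' dual window\<close>

text \<open>\<open>cell t\<close> is the first index whose interval \<open>[-n - 1/2, n + 1/2)\<close> contains \<open>t\<close>.\<close>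

definition cell :: "real \<Rightarrow> nat" where
  "cell t = nat \<bar>\<lfloor>t + 1/2\<rfloor>\<bar>"

text \<open>The indicators encode the summation range n \<ge> \<open>cell t\<close>. In this form
  the window can be integrated term by term against a Gabor atom.\<close>

definition dual_window :: "real \<Rightarrow> real" where
  "dual_window t = (\<Sum>n. (-1) ^ n * gauss_coeff n * exp (pi * t\<^sup>2) * indicator {- real n - 1/2..<real n + 1/2} t)"

lemma cell_le_iff: "cell t \<le> n \<longleftrightarrow> t \<in> {- real n - 1/2..<real n + 1/2}"
proof -
  have "cell t \<le> n \<longleftrightarrow> - int n \<le> \<lfloor>t + 1/2\<rfloor> \<and> \<lfloor>t + 1/2\<rfloor> < int n + 1"
    unfolding cell_def by linarith
  then show ?thesis
    by (simp add: le_floor_iff floor_less_iff) linarith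
qed

lemma abs_le_cell: "\<bar>t\<bar> \<le> real (cell t) + 1/2"
  using cell_le_iff[of t "cell t"] by auto

lemma cell_le_abs: "real (cell t) - 1/2 \<le> \<bar>t\<bar>"
  unfolding cell_def by linarith

text \<open>The indicators remove exactly the indices below \<open>cell t\<close>, and the remaining
  coefficients decay so fast that their sum is within a third of the first one.\<close>

lemma dual_window_shift:
  "dual_window t = exp (pi * t\<^sup>2) * (\<Sum>l. (-1) ^ (l + cell t) * gauss_coeff (l + cell t))"
  "\<bar>(\<Sum>l. (-1) ^ (l + cell t) * gauss_coeff (l + cell t)) - (-1) ^ cell t * gauss_coeff (cell t)\<bar> \<le> gauss_coeff (cell t) / 3"
  "(\<lambda>n. (-1) ^ n * gauss_coeff n * exp (pi * t\<^sup>2) * indicator {- real n - 1/2..<real n + 1/2} t) sums dual_window t"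
proof -
  define N where "N = cell t"
  define f where "f l = (-1) ^ (l + N) * gauss_coeff (l + N)" for l
  have fb: "norm (f (Suc m)) \<le> gauss_coeff N * (1/4) ^ Suc m" for m
  proof -
    have "norm (f (Suc m)) = gauss_coeff (Suc m + N)"
      using gauss_coeff_pos[of "Suc m + N"] by (simp add: f_def abs_mult)
    also have "\<dots> \<le> gauss_coeff N * exp (- pi) ^ Suc m"
    proof -
      \<comment> \<open>With M = m + 1, (M + N + 1/2)^2 - (N + 1/2)^2 = M (M + 2N + 1) \<ge>
        M.\<close>
      have "real (Suc m) * 1 \<le> real (Suc m) * (real (Suc m) + 2 * real N + 1)"
        by (intro mult_left_mono) auto
      then have "pi * real (Suc m) \<le> pi * ((real (Suc m + N) + 1/2)\<^sup>2 - (real N + 1/2)\<^sup>2)"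
        by (intro mult_left_mono) (auto simp: power2_eq_square algebra_simps)
      then show ?thesis
        unfolding gauss_coeff_def exp_of_nat2_mult [symmetric] exp_add [symmetric]
        by (simp add: algebra_simps)
    qed
    also have "\<dots> \<le> gauss_coeff N * (1/4) ^ Suc m"
      using exp_minus_pi_le gauss_coeff_pos[of N] by (intro mult_left_mono power_mono) auto
    finally show ?thesis .
  qed
  note f = norm_suminf_minus_head_le[OF fb]
  show "\<bar>(\<Sum>l. (-1) ^ (l + cell t) * gauss_coeff (l + cell t)) - (-1) ^ cell t * gauss_coeff (cell t)\<bar> \<le> gauss_coeff (cell t) / 3"
    using f(2) by (simp add: f_def N_def)
  define g where "g n = (-1) ^ n * gauss_coeff n * exp (pi * t\<^sup>2) * indicator {- real n - 1/2..<real n + 1/2} t" for n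
  have g: "g n = (if n < N then 0 else exp (pi * t\<^sup>2) * ((-1) ^ n * gauss_coeff n))" for n
    using cell_le_iff[of t n] by (auto simp: g_def N_def indicator_def)
  have gN: "g (l + N) = exp (pi * t\<^sup>2) * f l" for l
    by (simp add: g f_def)
  then have "summable (\<lambda>l. g (l + N))" using f(1) by simp
  then have "summable g" by (simp add: summable_iff_shift)
  then have "suminf g = (\<Sum>l. g (l + N)) + (\<Sum>n<N. g n)"
    by (rule suminf_split_initial_segment)
  also have "(\<Sum>n<N. g n) = 0" by (intro sum.neutral) (simp add: g)
  also have "(\<Sum>l. g (l + N)) = exp (pi * t\<^sup>2) * suminf f"
    unfolding gN by (rule suminf_mult[OF f(1)])
  finally show "dual_window t = exp (pi * t\<^sup>2) * (\<Sum>l. (-1) ^ (l + cell t) * gauss_coeff (l + cell t))"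
    by (simp add: dual_window_def g_def f_def[abs_def] N_def)
  have "(\<lambda>n. g n) sums dual_window t"
    using summable_sums[OF \<open>summable g\<close>] by (simp add: dual_window_def g_def[abs_def])
  then show "(\<lambda>n. (-1) ^ n * gauss_coeff n * exp (pi * t\<^sup>2) * indicator {- real n - 1/2..<real n + 1/2} t) sums dual_window t"
    by (simp add: g_def)
qed

text \<open>With a = \<open>cell t\<close> + 1/2 the exponent is -\<pi> (a - |t|) (a + |t|). Hence
  the window has order one only where |t| is within about 1/a of a. The lengths 1/a have a divergent
  sum, so it is not square integrable.\<close>

lemma dual_window_bounds:
  defines "w \<equiv> \<lambda>t. exp (pi * (t\<^sup>2 - (real (cell t) + 1/2)\<^sup>2))"
  shows "2/3 * w t \<le> \<bar>dual_window t\<bar>" "\<bar>dual_window t\<bar> \<le> 4/3 * w t"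
proof -
  let ?S = "\<Sum>l. (-1) ^ (l + cell t) * gauss_coeff (l + cell t)"
  have "\<bar>(-1) ^ cell t * gauss_coeff (cell t)\<bar> = gauss_coeff (cell t)"
    using gauss_coeff_pos[of "cell t"] by (simp add: abs_mult)
  with dual_window_shift(2)[of t]
  have S: "2/3 * gauss_coeff (cell t) \<le> \<bar>?S\<bar>" "\<bar>?S\<bar> \<le> 4/3 * gauss_coeff (cell t)"
    by linarith+
  have w: "w t = exp (pi * t\<^sup>2) * gauss_coeff (cell t)"
    by (simp add: w_def gauss_coeff_def algebra_simps flip: exp_add)
  have "\<bar>dual_window t\<bar> = exp (pi * t\<^sup>2) * \<bar>?S\<bar>"
    unfolding dual_window_shift(1) by (simp add: abs_mult)
  then show "2/3 * w t \<le> \<bar>dual_window t\<bar>" "\<bar>dual_window t\<bar> \<le> 4/3 * w t"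
    using S unfolding w by simp_all
qed

lemma dual_window_measurable [measurable]: "dual_window \<in> borel_measurable borel"
  unfolding dual_window_def by measurable

lemma cell_measurable [measurable]: "cell \<in> measurable borel (count_space UNIV)"
  unfolding cell_def by measurable

text \<open>The factor vanishes at the half-integers, where the dual window fails to be square integrable.\<close>

definition dual_diff :: "nat \<Rightarrow> real \<Rightarrow> complex" where
  "dual_diff n t = of_real (dual_window t) * (1 - exp (2 * pi * \<i> * of_nat n * of_real (t - 1/2)))"

lemma dual_diff_measurable [measurable]: "dual_diff n \<in> borel_measurable borel"
  unfolding dual_diff_def by measurable

lemma norm_one_minus_exp_le: "norm (1 - exp (\<i> * of_real x)) \<le> \<bar>x\<bar>"
  using Taylor_exp[of "\<i> * of_real x" 0] by (simp add: norm_mult norm_minus_commute)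

lemma exp_2pi_int [simp]: "exp (2 * of_real pi * \<i> * of_int k) = 1"
  using exp_integer_2pi[of "of_int k"] by (simp add: mult_ac)

text \<open>With r the gap from |t| to the half-integer \<open>cell t\<close> + 1/2, the window is
  O(exp(-r|t|)) and the extra factor is O(n r). Their product is O(n / (1 + |t|)), which is square
  integrable.\<close>

lemma norm_dual_diff_le: "norm (dual_diff n t) \<le> 3 * pi * (real n + 1) / (1 + \<bar>t\<bar>)"
proof -
  define r where "r = real (cell t) + 1/2 - \<bar>t\<bar>"
  have r: "0 \<le> r" "r \<le> 1"
    using abs_le_cell[of t] cell_le_abs[of t] by (auto simp: r_def)
  have "t\<^sup>2 - (real (cell t) + 1/2)\<^sup>2 = - (r * (r + 2 * \<bar>t\<bar>))"
    by (simp add: r_def power2_eq_square algebra_simps abs_if)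
  also have "\<dots> \<le> - (r * \<bar>t\<bar>)" using r by (simp add: mult_left_mono)
  finally have "pi * (t\<^sup>2 - (real (cell t) + 1/2)\<^sup>2) \<le> pi * - (r * \<bar>t\<bar>)"
    by (intro mult_left_mono) auto
  also have "\<dots> \<le> - (r * \<bar>t\<bar>)"
    using mult_right_mono[of 1 pi "r * \<bar>t\<bar>"] pi_gt3 r by simp
  finally have e: "exp (pi * (t\<^sup>2 - (real (cell t) + 1/2)\<^sup>2)) \<le> exp (- (r * \<bar>t\<bar>))" by simp
  have dw: "\<bar>dual_window t\<bar> \<le> 4/3 * exp (- (r * \<bar>t\<bar>))"
    by (rule order_trans[OF dual_window_bounds(2) mult_left_mono[OF e]]) simp
  have phase: "norm (1 - exp (2 * pi * \<i> * of_nat n * of_real (t - 1/2))) \<le> 2 * pi * real n * r"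
  proof -
    \<comment> \<open>The relevant half-integer is \<open>cell t\<close> + 1/2 on the right and its
      negative on the left. Both differ from 1/2 by an integer, so only the offset q enters the
      phase.\<close>
    obtain k :: int and q where q: "t - 1/2 = of_int k + q" "\<bar>q\<bar> = r"
    proof (cases "t \<ge> 0")
      case True
      show ?thesis by (rule that[of "int (cell t)" "- r"]) (use True r in \<open>auto simp: r_def\<close>)
    next
      case False
      show ?thesis by (rule that[of "- int (cell t) - 1" r]) (use False r in \<open>auto simp: r_def\<close>)
    qed
    have "exp (2 * pi * \<i> * of_nat n * of_real (t - 1/2)) = exp (2 * pi * \<i> * of_int (int n * k)) * exp (\<i> * of_real (2 * pi * real n * q))"
      unfolding q(1) exp_add [symmetric] by (simp add: algebra_simps)
    also have "\<dots> = exp (\<i> * of_real (2 * pi * real n * q))"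
      using exp_2pi_int[of "int n * k"] by simp
    finally show ?thesis
      using norm_one_minus_exp_le[of "2 * pi * real n * q"] q(2) by (simp add: abs_mult)
  qed
  have "norm (dual_diff n t) \<le> 4/3 * exp (- (r * \<bar>t\<bar>)) * (2 * pi * real n * r)"
    unfolding dual_diff_def norm_mult
    using dw phase by (intro mult_mono) auto
  also have "\<dots> = 8/3 * pi * real n * (r * exp (- (r * \<bar>t\<bar>)))" by simp
  also have "r * exp (- (r * \<bar>t\<bar>)) \<le> 1 / (1 + \<bar>t\<bar>)"
  proof -
    have "r * (1 + \<bar>t\<bar>) \<le> 1 + r * \<bar>t\<bar>" using r by (simp add: algebra_simps)
    also have "\<dots> \<le> exp (r * \<bar>t\<bar>)" by (rule exp_ge_add_one_self)
    finally show ?thesis by (simp add: exp_minus field_simps)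
  qed
  then have "8/3 * pi * real n * (r * exp (- (r * \<bar>t\<bar>))) \<le> 3 * pi * (real n + 1) * (1 / (1 + \<bar>t\<bar>))"
    using r mult_nonneg_nonneg[OF pi_ge_zero of_nat_0_le_iff[of n]]
    by (intro mult_mono) (auto simp: algebra_simps)
  finally show ?thesis by simp
qed

lemma integrable_inverse_square: "integrable lborel (\<lambda>t::real. 1 / (1 + \<bar>t\<bar>)\<^sup>2)"
proof -
  have "integrable lborel (\<lambda>t::real. inverse (1 + t\<^sup>2))"
    using integrable_inverse_1_plus_square by (simp add: set_integrable_def einterval_def)
  then show ?thesis
  proof (rule Bochner_Integration.integrable_bound)
    show "AE t::real in lborel. norm (1 / (1 + \<bar>t\<bar>)\<^sup>2) \<le> norm (inverse (1 + t\<^sup>2))"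
    proof (rule AE_I2)
      fix t :: real
      have "1 + t\<^sup>2 \<le> (1 + \<bar>t\<bar>)\<^sup>2" by (simp add: power2_sum)
      moreover have "0 < 1 + t\<^sup>2" by (simp add: add_pos_nonneg)
      ultimately show "norm (1 / (1 + \<bar>t\<bar>)\<^sup>2) \<le> norm (inverse (1 + t\<^sup>2))"
        by (simp add: field_simps)
    qed
  qed simp
qed

lemma dual_diff_L2: "dual_diff n \<in> L2 lborel"
  unfolding L2_def
proof (intro CollectI conjI)
  let ?K = "(3 * pi * (real n + 1))\<^sup>2"
  have "integrable lborel (\<lambda>t. ?K * (1 / (1 + \<bar>t\<bar>)\<^sup>2))"
    by (intro integrable_mult_right integrable_inverse_square)
  then show "integrable lborel (\<lambda>t. (norm (dual_diff n t))\<^sup>2)"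
  proof (rule Bochner_Integration.integrable_bound)
    show "AE t in lborel. norm ((norm (dual_diff n t))\<^sup>2) \<le> norm (?K * (1 / (1 + \<bar>t\<bar>)\<^sup>2))"
    proof (rule AE_I2)
      fix t
      show "norm ((norm (dual_diff n t))\<^sup>2) \<le> norm (?K * (1 / (1 + \<bar>t\<bar>)\<^sup>2))"
        using power_mono[OF norm_dual_diff_le norm_ge_zero, of n t 2]
        by (simp add: power_divide abs_mult)
    qed
  qed simp
qed simp

section \<open>Biorthogonality\<close>

lemma has_bochner_integral_exp_Icc:
  fixes w :: complex
  assumes "a \<le> b" "w \<noteq> 0"
  shows "has_bochner_integral lborel (\<lambda>t. indicator {a..b} t *\<^sub>R exp (w * of_real t))
    ((exp (w * of_real b) - exp (w * of_real a)) / w)"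
proof -
  have "has_bochner_integral lborel (\<lambda>t. indicator {a..b} t *\<^sub>R exp (w * of_real t))
      (exp (w * of_real b) / w - exp (w * of_real a) / w)"
  proof (rule has_bochner_integral_FTC_Icc[OF assms(1)])
    fix t :: real
    have "((\<lambda>z. exp (w * z) / w) has_field_derivative exp (w * of_real t)) (at (of_real t))"
      using assms(2) by (auto intro!: derivative_eq_intros)
    then have "((\<lambda>t. exp (w * of_real t) / w) has_vector_derivative exp (w * of_real t)) (at t)"
      by (rule has_vector_derivative_real_field)
    then show "((\<lambda>t. exp (w * of_real t) / w) has_vector_derivative exp (w * of_real t)) (at t within {a..b})"
      by (rule has_vector_derivative_at_within)
  qed (auto intro!: continuous_intros)
  then show ?thesis by (simp add: diff_divide_distrib)
qed

lemma sums_gauss_coeff_sinh_zero: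
  "(\<lambda>n. (-1) ^ n * gauss_coeff n * sinh (2 * pi * of_int k * (real n + 1/2))) sums 0"
proof -
  txt \<open>Quasi-periodicity moves the zero at \<open>(1/2, 1/2)\<close> to \<open>(1/2 + k, 1/2)\<close>, where the paired series is the claimed one.\<close>
  have "zak_gaussian (1/2, 1/2) = 0"
  proof -
    obtain C where "\<And>p. p \<in> unit_square \<Longrightarrow> norm (zak_gaussian p) \<le> C * rho (1/2) (1/2) p"
      using zak_gaussian_bounds by metis
    from this[of "(1/2, 1/2)"] show ?thesis by (simp add: unit_square_def rho_def)
  qed
  then have "((\<lambda>j. zak_term j (1/2, 1/2)) has_sum 0) UNIV"
    using has_sum_zak_gaussian[of "(1/2, 1/2)"] by simp
  then have "((\<lambda>j. exp (\<i> * pi * of_int k) * zak_term j (1/2, 1/2)) has_sum exp (\<i> * pi * of_int k) * 0) UNIV"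
    by (rule has_sum_cmult_right)
  moreover have "exp (\<i> * pi * of_int k) * zak_term (j - k) (1/2, 1/2) = zak_term j (1/2 + of_int k, 1/2)" for j
  proof -
    have "exp (2 * complex_of_real pi * \<i> * of_int j * of_real (1/2))
        = exp (\<i> * pi * of_int k) * exp (2 * complex_of_real pi * \<i> * of_int (j - k) * of_real (1/2))"
      unfolding exp_add [symmetric] by (rule arg_cong[of _ _ exp]) (simp add: algebra_simps)
    then show ?thesis by (simp add: zak_term_def algebra_simps)
  qed
  ultimately have "((\<lambda>j. zak_term (j + 1) (1/2 + of_int k, 1/2)) has_sum 0) UNIV"
    by (subst has_sum_reindex_bij_witness[where i = "\<lambda>j. j + k - 1" and j = "\<lambda>j. j + 1 - k" and T = UNIV
          and h = "\<lambda>j. exp (\<i> * pi * of_int k) * zak_term j (1/2, 1/2)"])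
       (auto simp: algebra_simps)
  from sums_pair_int[OF this]
  have *: "(\<lambda>m. zak_term (int m + 1) (1/2 + of_int k, 1/2) + zak_term (- int m) (1/2 + of_int k, 1/2)) sums 0"
    by simp
  define K where "K = - 2 * complex_of_real (2 powr (1/4)) * exp (- pi * (of_int k)\<^sup>2 + \<i> * pi * 0)"
  have K: "K \<noteq> 0" by (simp add: K_def)
  have "zak_term (int m + 1) (1/2 + of_int k, 1/2) + zak_term (- int m) (1/2 + of_int k, 1/2)
     = K * of_real ((-1) ^ m * gauss_coeff m * sinh (2 * pi * of_int k * (real m + 1/2)))" for m
  proof -
    have X: "of_nat (2 * m + 1) * (of_real pi * Complex (of_int k) 0)
        = complex_of_real (2 * pi * of_int k * (real m + 1/2))"
      by (simp add: complex_eq_iff algebra_simps)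
    have Y: "sinh (complex_of_real x) = of_real (sinh x)" for x
      by (simp add: sinh_field_def exp_of_real flip: of_real_minus)
    show ?thesis
      using zak_gaussian_pair[of m "of_int k" 0] unfolding X Y by (simp add: K_def)
  qed
  with * have "(\<lambda>m. K * complex_of_real ((-1) ^ m * gauss_coeff m * sinh (2 * pi * of_int k * (real m + 1/2)))) sums 0"
    by simp
  from sums_mult[OF this, of "1 / K"] K
  have "(\<lambda>m. complex_of_real ((-1) ^ m * gauss_coeff m * sinh (2 * pi * of_int k * (real m + 1/2)))) sums of_real 0"
    by simp
  then show ?thesis by (simp only: sums_of_real_iff)
qed

text \<open>The sum is half the derivative of theta_1 at 0 for nome exp(-\<pi>). It is positive
  because the first term is at least three times the rest.\<close>

lemma gauss_coeff_odd_sum_pos: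
  "summable (\<lambda>n. (-1) ^ n * gauss_coeff n * (2 * real n + 1))"
  "(\<Sum>n. (-1) ^ n * gauss_coeff n * (2 * real n + 1)) > 0"
proof -
  have b: "norm ((-1) ^ Suc m * gauss_coeff (Suc m) * (2 * real (Suc m) + 1)) \<le> gauss_coeff 0 * (1/4) ^ Suc m" for m
  proof -
    have "norm ((-1) ^ Suc m * gauss_coeff (Suc m) * (2 * real (Suc m) + 1)) = gauss_coeff (Suc m) * (2 * real (Suc m) + 1) * 1"
      using gauss_coeff_pos[of "Suc m"] by (simp add: abs_mult)
    also have "\<dots> \<le> gauss_coeff (Suc m) * (2 * real (Suc m) + 1) * exp (pi * real (Suc m))"
      using gauss_coeff_pos[of "Suc m"] by (intro mult_left_mono) auto
    also note gauss_coeff_decay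
    finally show ?thesis .
  qed
  note * = norm_suminf_minus_head_le[of "\<lambda>n. (-1) ^ n * gauss_coeff n * (2 * real n + 1)", OF b]
  show "summable (\<lambda>n. (-1) ^ n * gauss_coeff n * (2 * real n + 1))" by (rule *(1))
  show "(\<Sum>n. (-1) ^ n * gauss_coeff n * (2 * real n + 1)) > 0"
    using abs_le_D2[OF *(2)[unfolded real_norm_def]] gauss_coeff_pos[of 0] by simp
qed

text \<open>Majorant for termwise integration: the exponential bounds an atom translated by K on
  [-n - 1/2, n + 1/2] after multiplication by exp(\<pi> t^2), and 2n + 1 is the length of that
  interval.\<close>

lemma summable_gauss_coeff_exp:
  assumes "0 \<le> K"
  shows "summable (\<lambda>n. gauss_coeff n * exp (2 * pi * K * (real n + 1/2)) * (2 * real n + 1))"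
proof (rule summable_comparison_test')
  show "summable (\<lambda>n. exp (pi * (K + 1/2)\<^sup>2) * (1/4) ^ n :: real)"
    by (intro summable_mult summable_geometric) simp
  fix n :: nat assume "0 \<le> n"
  let ?x = "real n + 1/2"
  have lin: "2 * real n + 1 \<le> 3 ^ n" by (induction n) auto
  have "gauss_coeff n * exp (2 * pi * K * ?x) = exp (pi * (2 * K * ?x - ?x\<^sup>2))"
    by (simp add: gauss_coeff_def algebra_simps flip: exp_add)
  also have "\<dots> \<le> exp (pi * ((K + 1/2)\<^sup>2 - ?x))"
  proof -
    \<comment> \<open>This square is chosen so that the Gaussian decay beats exp(2\<pi>Kx) and still
      leaves exp(-\<pi>x).\<close>
    have "0 \<le> (?x - (K + 1/2))\<^sup>2" by simp
    then have "2 * K * ?x - ?x\<^sup>2 \<le> (K + 1/2)\<^sup>2 - ?x"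
      by (simp add: power2_eq_square algebra_simps)
    then show ?thesis by (simp add: mult_left_mono)
  qed
  also have "\<dots> \<le> exp (pi * (K + 1/2)\<^sup>2) * exp (- pi) ^ n"
    unfolding exp_of_nat2_mult [symmetric] exp_add [symmetric] by (simp add: algebra_simps)
  also have "\<dots> \<le> exp (pi * (K + 1/2)\<^sup>2) * (1/12) ^ n"
    by (intro mult_left_mono power_mono exp_minus_pi_le) auto
  finally have "gauss_coeff n * exp (2 * pi * K * ?x) * (2 * real n + 1) \<le> exp (pi * (K + 1/2)\<^sup>2) * (1/12) ^ n * 3 ^ n"
    by (rule mult_mono[OF _ lin]) auto
  also have "\<dots> = exp (pi * (K + 1/2)\<^sup>2) * (1/4) ^ n"
    by (simp add: mult.assoc flip: power_mult_distrib)
  finally show "norm (gauss_coeff n * exp (2 * pi * K * ?x) * (2 * real n + 1)) \<le> exp (pi * (K + 1/2)\<^sup>2) * (1/4) ^ n"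
    using gauss_coeff_pos[of n] by (simp add: abs_mult)
qed

text \<open>This is the integral of the Gaussian against the dual window. The window is not
  normalised, so the constant stays in the biorthogonality relation.\<close>

definition dual_const :: real where
  "dual_const = 2 powr (1/4) * (\<Sum>n. (-1) ^ n * gauss_coeff n * (2 * real n + 1))"

lemma dual_const_pos: "dual_const > 0"
  using gauss_coeff_odd_sum_pos(2) by (simp add: dual_const_def)

text \<open>At both endpoints \<plusminus>(n + 1/2) the oscillating factor takes the same value
  (-1)^m, since they differ by an integer. The difference of the primitives is therefore a
  sinh.\<close>

lemma integral_exp_symmetric_half_odd:
  fixes k m :: int and n :: nat and w :: complex
  defines "w \<equiv> Complex (of_int k) (of_int m)"
  assumes "w \<noteq> 0"
  shows "has_bochner_integral lborel (\<lambda>t. indicator {- real n - 1/2..real n + 1/2} t *\<^sub>R exp (2 * pi * w * of_real t))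
    (exp (\<i> * pi * of_int m) / (pi * w) * of_real (sinh (2 * pi * of_int k * (real n + 1/2))))"
proof -
  let ?x = "real n + 1/2"
  define s where "s = exp (\<i> * pi * of_int m)"
  have s2: "s * s = 1"
    unfolding s_def exp_add [symmetric] using exp_2pi_int[of m] by (simp add: algebra_simps)
  then have s_inv: "exp (- (\<i> * pi * of_int m)) = s"
    using s_def by (simp add: exp_minus inverse_unique)
  have w: "w = of_int k + \<i> * of_int m" by (simp add: w_def complex_eq_iff)
  have one: "exp (2 * complex_of_real pi * \<i> * of_int j) = 1" for j by (rule exp_2pi_int)
  have "exp (2 * pi * w * of_real ?x) = exp (of_real (2 * pi * of_int k * ?x)) * (exp (2 * complex_of_real pi * \<i> * of_int (m * int n)) * s)"
    unfolding s_def exp_add [symmetric] by (rule arg_cong[of _ _ exp]) (simp add: w algebra_simps)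
  then have p: "exp (2 * pi * w * of_real ?x) = of_real (exp (2 * pi * of_int k * ?x)) * s"
    unfolding one exp_of_real by simp
  have "exp (2 * pi * w * of_real (- ?x)) = exp (of_real (- (2 * pi * of_int k * ?x)))
      * (exp (2 * complex_of_real pi * \<i> * of_int (- (m * int n))) * exp (- (\<i> * pi * of_int m)))"
    unfolding exp_add [symmetric] by (rule arg_cong[of _ _ exp]) (simp add: w algebra_simps)
  then have q: "exp (2 * pi * w * of_real (- ?x)) = of_real (exp (- (2 * pi * of_int k * ?x))) * s"
    unfolding one exp_of_real s_inv by simp
  have "has_bochner_integral lborel (\<lambda>t. indicator {- ?x..?x} t *\<^sub>R exp (2 * pi * w * of_real t))
     ((exp (2 * pi * w * of_real ?x) - exp (2 * pi * w * of_real (- ?x))) / (2 * pi * w))"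
    by (rule has_bochner_integral_exp_Icc) (use assms in auto)
  also have "(exp (2 * pi * w * of_real ?x) - exp (2 * pi * w * of_real (- ?x))) / (2 * pi * w)
      = s / (pi * w) * of_real (sinh (2 * pi * of_int k * ?x))"
    unfolding p q sinh_field_def by (simp add: field_simps)
  finally show ?thesis unfolding s_def by simp
qed

text \<open>Multiplying the translated Gaussian by exp(\<pi> t^2) leaves a pure exponential, so each
  term is integrated explicitly. For k = m = 0 the integrals sum to \<open>dual_const\<close>.
  Otherwise they are multiples of the series in \<open>sums_gauss_coeff_sinh_zero\<close>, which
  vanishes because the Zak transform has a zero.\<close>

lemma gabor_dual_window_integral:
  fixes k m :: int
  shows "integrable lborel (\<lambda>t. gabor_system gaussian (k, m) t * of_real (dual_window t))" (is ?int)
    and "(LINT t|lborel. gabor_system gaussian (k, m) t * of_real (dual_window t))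
      = (if k = 0 \<and> m = 0 then of_real dual_const else 0)" (is ?eq)
proof -
  define w where "w = Complex (of_int k) (of_int m)"
  define C where "C = complex_of_real (2 powr (1/4) * exp (- pi * (of_int k)\<^sup>2))"
  define f where "f n t = C * of_real ((-1) ^ n * gauss_coeff n) *
    (indicator {- real n - 1/2..<real n + 1/2} t *\<^sub>R exp (2 * pi * w * of_real t))" for n t
  have [measurable]: "f n \<in> borel_measurable lborel" for n
    unfolding f_def by measurable
  have w_eq: "w = of_int k + \<i> * of_int m" by (simp add: w_def complex_eq_iff)
  have f_eq: "gabor_system gaussian (k, m) t * of_real ((-1) ^ n * gauss_coeff n * exp (pi * t\<^sup>2) * indicator {- real n - 1/2..<real n + 1/2} t)
      = f n t" for n t
  proof -
    have "exp (2 * pi * \<i> * of_int m * of_real t) * (of_real (exp (- pi * (t - of_int k)\<^sup>2)) * of_real (exp (pi * t\<^sup>2)))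
      = of_real (exp (- pi * (of_int k)\<^sup>2)) * exp (2 * pi * w * of_real t)"
      unfolding exp_of_real [symmetric] exp_add [symmetric]
      by (rule arg_cong[of _ _ exp]) (simp add: w_eq power2_eq_square algebra_simps)
    then show ?thesis
      by (simp add: f_def C_def gabor_system_def modulation_def translation_def gaussian_def scaleR_conv_of_real mult_ac)
  qed
  have f_sums: "(\<lambda>n. f n t) sums (gabor_system gaussian (k, m) t * of_real (dual_window t))" for t
    using sums_mult[OF sums_of_real[OF dual_window_shift(3)[of t]], of "gabor_system gaussian (k, m) t"]
    unfolding f_eq .
  \<comment> \<open>The half-open and closed intervals differ by one point only.\<close>
  have closed: "has_bochner_integral lborel (f n) z \<longleftrightarrow> has_bochner_integral lborel
      (\<lambda>t. C * of_real ((-1) ^ n * gauss_coeff n) * (indicator {- real n - 1/2..real n + 1/2} t *\<^sub>R exp (2 * pi * w * of_real t))) z" for n z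
  proof (rule has_bochner_integral_cong_AE)
    show "AE t in lborel. f n t = C * of_real ((-1) ^ n * gauss_coeff n) * (indicator {- real n - 1/2..real n + 1/2} t *\<^sub>R exp (2 * pi * w * of_real t))"
      using AE_lborel_singleton[of "real n + 1/2"]
      by eventually_elim (auto simp: f_def indicator_def)
  qed auto
  let ?B = "\<lambda>n. norm C * (gauss_coeff n * exp (2 * pi * \<bar>of_int k\<bar> * (real n + 1/2)))"
  have fb: "norm (f n t) \<le> ?B n * indicator {- real n - 1/2..<real n + 1/2} t" for n t
  proof (cases "t \<in> {- real n - 1/2..<real n + 1/2}")
    case True
    have "of_int k * t \<le> \<bar>of_int k * t\<bar>" by simp
    also have "\<dots> \<le> \<bar>of_int k\<bar> * (real n + 1/2)"
      unfolding abs_mult using True by (intro mult_left_mono) auto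
    finally have "2 * pi * (of_int k * t) \<le> 2 * pi * (\<bar>of_int k\<bar> * (real n + 1/2))"
      by (intro mult_left_mono) auto
    moreover have "norm (exp (2 * pi * w * of_real t)) = exp (2 * pi * (of_int k * t))"
      by (simp add: w_eq mult_ac)
    ultimately have "norm (exp (2 * pi * w * of_real t)) \<le> exp (2 * pi * \<bar>of_int k\<bar> * (real n + 1/2))"
      by (simp only: exp_le_cancel_iff mult.assoc)
    then show ?thesis
      using True gauss_coeff_pos[of n]
      by (simp add: f_def norm_mult norm_power mult_left_mono mult.assoc)
  qed (simp add: f_def)
  have B_int: "integrable lborel (\<lambda>t. ?B n * indicator {- real n - 1/2..<real n + 1/2} t :: real)" for n
    by (intro integrable_mult_right integrable_real_indicator) (auto simp: ennreal_eq_0_iff)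
  have f_int: "integrable lborel (f n)" for n
    by (rule Bochner_Integration.integrable_bound[OF B_int]) (use fb in \<open>auto intro: order_trans[OF _ abs_ge_self]\<close>)
  have summ: "summable (\<lambda>n. LINT t|lborel. norm (f n t))"
  proof (rule summable_comparison_test')
    show "summable (\<lambda>n. norm C * (gauss_coeff n * exp (2 * pi * \<bar>of_int k\<bar> * (real n + 1/2)) * (2 * real n + 1)))"
      by (intro summable_mult summable_gauss_coeff_exp) simp
    fix n :: nat
    have "(LINT t|lborel. norm (f n t)) \<le> (LINT t|lborel. ?B n * indicator {- real n - 1/2..<real n + 1/2} t)"
      by (rule integral_mono[OF integrable_norm[OF f_int] B_int fb])
    also have "\<dots> = norm C * (gauss_coeff n * exp (2 * pi * \<bar>of_int k\<bar> * (real n + 1/2)) * (2 * real n + 1))"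
      by simp
    finally show "norm (LINT t|lborel. norm (f n t)) \<le> norm C * (gauss_coeff n * exp (2 * pi * \<bar>of_int k\<bar> * (real n + 1/2)) * (2 * real n + 1))"
      by simp
  qed
  have f_abs: "AE t in lborel. summable (\<lambda>n. norm (f n t))"
  proof (rule AE_I2, rule summable_comparison_test')
    fix t n
    show "summable (\<lambda>n. norm C * (gauss_coeff n * exp (2 * pi * \<bar>of_int k\<bar> * (real n + 1/2)) * (2 * real n + 1)))"
      by (intro summable_mult summable_gauss_coeff_exp) simp
    have "norm (f n t) \<le> ?B n * 1"
      using gauss_coeff_pos[of n] by (intro order_trans[OF fb] mult_left_mono) (auto simp: indicator_def)
    also have "\<dots> \<le> ?B n * (2 * real n + 1)"
      using gauss_coeff_pos[of n] by (intro mult_left_mono) auto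
    finally show "norm (norm (f n t)) \<le> norm C * (gauss_coeff n * exp (2 * pi * \<bar>of_int k\<bar> * (real n + 1/2)) * (2 * real n + 1))"
      by simp
  qed
  have lim: "(\<lambda>t. \<Sum>n. f n t) = (\<lambda>t. gabor_system gaussian (k, m) t * of_real (dual_window t))"
    using f_sums by (simp add: sums_iff fun_eq_iff)
  show ?int using integrable_suminf[OF f_int f_abs summ] unfolding lim .
  have I: "(LINT t|lborel. gabor_system gaussian (k, m) t * of_real (dual_window t)) = (\<Sum>n. integral\<^sup>L lborel (f n))"
    using integral_suminf[OF f_int f_abs summ] unfolding lim .
  show ?eq
  proof (cases "k = 0 \<and> m = 0")
    case True
    have "integral\<^sup>L lborel (f n) = of_real (2 powr (1/4) * ((-1) ^ n * gauss_coeff n * (2 * real n + 1)))" for n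
      using True by (simp add: f_def[abs_def] C_def w_eq scaleR_conv_of_real)
    moreover have "(\<lambda>n. of_real (2 powr (1/4) * ((-1) ^ n * gauss_coeff n * (2 * real n + 1)))) sums complex_of_real dual_const"
      unfolding dual_const_def by (intro sums_of_real sums_mult summable_sums gauss_coeff_odd_sum_pos)
    ultimately show ?thesis unfolding I using True by (simp add: sums_iff)
  next
    case False
    then have w0: "w \<noteq> 0" by (auto simp: w_def complex_eq_iff)
    define D where "D = C * (exp (\<i> * pi * of_int m) / (pi * w))"
    have "integral\<^sup>L lborel (f n) = D * of_real ((-1) ^ n * gauss_coeff n * sinh (2 * pi * of_int k * (real n + 1/2)))" for n
    proof -
      have "has_bochner_integral lborel (f n)
          (C * of_real ((-1) ^ n * gauss_coeff n) * (exp (\<i> * pi * of_int m) / (pi * w) * of_real (sinh (2 * pi * of_int k * (real n + 1/2)))))"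
        unfolding closed w_def
        by (intro has_bochner_integral_mult_right integral_exp_symmetric_half_odd) (use w0 in \<open>simp add: w_def\<close>)
      then show ?thesis
        by (simp add: has_bochner_integral_integral_eq D_def mult_ac)
    qed
    moreover have "(\<lambda>n. D * of_real ((-1) ^ n * gauss_coeff n * sinh (2 * pi * of_int k * (real n + 1/2)))) sums (D * of_real 0)"
      by (intro sums_mult sums_of_real sums_gauss_coeff_sinh_zero)
    ultimately show ?thesis unfolding I if_not_P[OF False] by (simp add: sums_iff)
  qed
qed

text \<open>The phase in \<open>dual_diff\<close> shifts the modulation index by n, and its centre
  1/2 leaves the sign exp(i\<pi>n). Only the atoms (0,0) and (0,n) can therefore pair nontrivially
  with it.\<close>

lemma gabor_dual_diff_inner:
  "L2_inner lborel (gabor_system gaussian (k, m)) (dual_diff n)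
    = of_real dual_const * ((if k = 0 \<and> m = 0 then 1 else 0) - exp (\<i> * pi * of_nat n) * (if k = 0 \<and> m = int n then 1 else 0))"
proof -
  have "gabor_system gaussian (k, m) t * cnj (dual_diff n t)
      = gabor_system gaussian (k, m) t * of_real (dual_window t)
        - exp (\<i> * pi * of_nat n) * (gabor_system gaussian (k, m - int n) t * of_real (dual_window t))" for t
  proof -
    have "cnj (exp (2 * pi * \<i> * of_nat n * of_real (t - 1/2))) * exp (2 * pi * \<i> * of_int m * of_real t)
        = exp (\<i> * pi * of_nat n) * exp (2 * pi * \<i> * of_int (m - int n) * of_real t)"
      unfolding exp_cnj exp_add [symmetric] by (rule arg_cong[of _ _ exp]) (simp add: algebra_simps)
    then show ?thesis
      by (simp add: dual_diff_def gabor_system_def modulation_def algebra_simps)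
  qed
  then show ?thesis
    using gabor_dual_window_integral[of k m] gabor_dual_window_integral[of k "m - int n"]
    by (simp add: L2_inner_def)
qed

section \<open>Boundedness of the coefficients\<close>

lemma integral_exp_unit:
  "(LINT t|lborel. indicator {0..1} t *\<^sub>R exp (2 * pi * \<i> * of_int j * of_real t)) = (if j = 0 then 1 else 0)"
proof (cases "j = 0")
  case False
  have "has_bochner_integral lborel (\<lambda>t. indicator {0..1} t *\<^sub>R exp (2 * pi * \<i> * of_int j * of_real t))
      ((exp (2 * pi * \<i> * of_int j * of_real 1) - exp (2 * pi * \<i> * of_int j * of_real 0)) / (2 * pi * \<i> * of_int j))"
    by (rule has_bochner_integral_exp_Icc) (use False in auto)
  then show ?thesis
    using False exp_2pi_int[of j] by (simp add: has_bochner_integral_integral_eq)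
qed simp

lemma coefficients_bounded:
  fixes a :: "nat \<Rightarrow> complex"
  assumes "\<And>g. g \<in> L2 lborel \<Longrightarrow> \<exists>B. \<forall>n. norm (a n * L2_inner lborel (gabor_system gaussian (0, int n)) g) \<le> B"
  shows "\<exists>B. \<forall>n. norm (a n) \<le> B"
proof (rule ccontr)
  assume "\<nexists>B. \<forall>n. norm (a n) \<le> B"
  \<comment> \<open>The growth 4^l outweighs the factor 2^(-l) that the test function puts on the
    index \<open>p l\<close>, leaving 2^l.\<close>
  then have "\<forall>l::nat. \<exists>n. norm (a n) > 4 ^ l" by (meson not_le)
  then obtain p where p: "\<And>l::nat. norm (a (p l)) > 4 ^ l" by metis
  txt \<open>Testing against \<open>g\<close>, the sequence \<open>\<langle>\<phi>\<^bsub>0,n\<^esub>, g\<rangle>\<close> is nonnegative and at least \<open>2\<^bsup>-l\<^esup>\<close> at \<open>n = p l\<close>.\<close>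
  define e where "e l t = (1/2) ^ l * exp (2 * pi * \<i> * of_nat (p l) * of_real t)" for l :: nat and t :: real
  \<comment> \<open>Division by the Gaussian on [0,1], where it is bounded below, reduces the inner
    products with the atoms (0,n) to Fourier coefficients.\<close>
  define g where "g t = indicator {0..1} t *\<^sub>R ((\<Sum>l. e l t) / gaussian t)" for t
  have [measurable]: "e l \<in> borel_measurable borel" for l
    unfolding e_def by measurable
  have [measurable]: "gaussian \<in> borel_measurable borel"
    unfolding gaussian_def by measurable
  have [measurable]: "g \<in> borel_measurable lborel"
    unfolding g_def by measurable
  have ne: "norm (e l t) = (1/2) ^ l" for l t
    by (simp add: e_def norm_mult norm_power norm_divide)
  have se: "summable (\<lambda>l. norm (e l t))" for t
    unfolding ne by (simp add: summable_geometric)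
  have gpos: "gaussian t \<noteq> 0" for t by (simp add: gaussian_def)
  have "g \<in> L2 lborel"
    unfolding L2_def
  proof (intro CollectI conjI)
    let ?K = "(2 / norm (gaussian 1))\<^sup>2"
    have "integrable lborel (\<lambda>t. ?K * indicator {0..1::real} t)"
      by (intro integrable_mult_right integrable_real_indicator) auto
    then show "integrable lborel (\<lambda>t. (norm (g t))\<^sup>2)"
    proof (rule Bochner_Integration.integrable_bound)
      show "AE t in lborel. norm ((norm (g t))\<^sup>2) \<le> norm (?K * indicator {0..1::real} t)"
      proof (rule AE_I2)
        fix t :: real
        show "norm ((norm (g t))\<^sup>2) \<le> norm (?K * indicator {0..1::real} t)"
        proof (cases "t \<in> {0..1}")
          case True
          have "norm (\<Sum>l. e l t) \<le> (\<Sum>l. norm (e l t))" by (rule summable_norm[OF se])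
          also have "\<dots> = 2" unfolding ne by (simp add: suminf_geometric)
          finally have "norm (\<Sum>l. e l t) \<le> 2" .
          moreover have "norm (gaussian 1) \<le> norm (gaussian t)"
            using True by (simp add: gaussian_def norm_mult power_le_one)
          ultimately have "norm (\<Sum>l. e l t) / norm (gaussian t) \<le> 2 / norm (gaussian 1)"
            using gpos[of 1] by (intro frac_le) auto
          then have "(norm (g t))\<^sup>2 \<le> ?K"
            using True by (intro power_mono) (simp_all add: g_def norm_divide)
          then show ?thesis using True by simp
        qed (simp add: g_def)
      qed
    qed simp
  qed simp
  then obtain B where B: "\<And>n. norm (a n * L2_inner lborel (gabor_system gaussian (0, int n)) g) \<le> B"
    using assms by blast
  have sp: "summable (\<lambda>l. if p l = m then (1/2) ^ l else 0 :: real)" for m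
    by (rule summable_comparison_test'[where g = "\<lambda>l. (1/2::real) ^ l" and N = 0])
       (simp_all add: summable_geometric)
  \<comment> \<open>The map p need not be injective. Indices with the same value of p add
    nonnegative weights, so no cancellation occurs.\<close>
  have inner: "L2_inner lborel (gabor_system gaussian (0, int m)) g = of_real (\<Sum>l. if p l = m then (1/2) ^ l else 0)" for m
  proof -
    define f where "f l t = (1/2) ^ l * (indicator {0..1} t *\<^sub>R exp (2 * pi * \<i> * of_int (int m - int (p l)) * of_real t))" for l t
    have [measurable]: "f l \<in> borel_measurable lborel" for l
      unfolding f_def by measurable
    have nf: "norm (f l t) = (1/2) ^ l * indicator {0..1} t" for l t
      by (simp add: f_def norm_mult norm_power norm_divide)
    have if_nf: "integrable lborel (\<lambda>t. norm (f l t))" for l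
      unfolding nf by (intro integrable_mult_right integrable_real_indicator) auto
    have f_int: "integrable lborel (f l)" for l
      by (rule integrable_norm_cancel[OF if_nf]) simp
    have "gabor_system gaussian (0, int m) t * cnj (g t) = (\<Sum>l. f l t)" for t
    proof -
      have f_eq: "f l t = (indicator {0..1} t *\<^sub>R exp (2 * pi * \<i> * of_nat m * of_real t)) * cnj (e l t)" for l
      proof -
        have "exp (2 * pi * \<i> * of_int (int m - int (p l)) * of_real t)
            = exp (2 * pi * \<i> * of_nat m * of_real t) * cnj (exp (2 * pi * \<i> * of_nat (p l) * of_real t))"
          unfolding exp_cnj exp_add [symmetric] by (rule arg_cong[of _ _ exp]) (simp add: algebra_simps)
        then show ?thesis by (simp add: f_def e_def)
      qed
      have se': "summable (\<lambda>l. e l t)" by (rule summable_norm_cancel[OF se])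
      have "(\<Sum>l. f l t) = (indicator {0..1} t *\<^sub>R exp (2 * pi * \<i> * of_nat m * of_real t)) * (\<Sum>l. cnj (e l t))"
        unfolding f_eq using suminf_mult[OF sums_summable[OF sums_cnj[THEN iffD2, OF summable_sums[OF se']]]] .
      also have "(\<Sum>l. cnj (e l t)) = cnj (\<Sum>l. e l t)"
        using sums_cnj[of "\<lambda>l. e l t" "\<Sum>l. e l t"] summable_sums[OF se'] by (simp add: sums_iff)
      finally show ?thesis
        using gpos[of t] by (simp add: g_def gabor_system_def modulation_def translation_def gaussian_def)
    qed
    then have "L2_inner lborel (gabor_system gaussian (0, int m)) g = (LINT t|lborel. (\<Sum>l. f l t))"
      by (simp add: L2_inner_def)
    also have "\<dots> = (\<Sum>l. integral\<^sup>L lborel (f l))"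
    proof (rule integral_suminf[OF f_int])
      show "AE t in lborel. summable (\<lambda>l. norm (f l t))"
        unfolding nf by (intro AE_I2 summable_mult2 summable_geometric) simp
      show "summable (\<lambda>l. LINT t|lborel. norm (f l t))"
        unfolding nf by (simp add: summable_geometric)
    qed
    also have "(\<lambda>l. integral\<^sup>L lborel (f l)) = (\<lambda>l. of_real (if p l = m then (1/2) ^ l else 0))"
      unfolding f_def by (subst integral_mult_right_zero, subst integral_exp_unit) (auto simp: fun_eq_iff)
    finally show ?thesis
      unfolding suminf_of_real[OF sp] .
  qed
  have "2 ^ l \<le> B" for l :: nat
  proof -
    let ?S = "\<Sum>i. if p i = p l then (1/2) ^ i else 0 :: real"
    have "(\<Sum>i\<in>{l}. if p i = p l then (1/2) ^ i else 0 :: real) \<le> ?S"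
      by (rule sum_le_suminf[OF sp]) auto
    then have S: "(1/2) ^ l \<le> ?S" by simp
    have "(2::real) ^ l = 4 ^ l * (1/2) ^ l"
      by (simp flip: power_mult_distrib)
    also have "\<dots> \<le> norm (a (p l)) * ?S"
      using p[of l] S by (intro mult_mono) auto
    also have "\<dots> = norm (a (p l) * L2_inner lborel (gabor_system gaussian (0, int (p l))) g)"
    proof -
      have "0 \<le> ?S" using S by (rule order_trans[rotated]) simp
      then show ?thesis unfolding inner norm_mult norm_of_real by simp
    qed
    also have "\<dots> \<le> B" by (rule B)
    finally show ?thesis .
  qed
  moreover obtain l :: nat where "B < 2 ^ l"
    using real_arch_pow[of 2 B] by auto
  ultimately show False by (meson not_le)
qed

section \<open>Failure of weak boundedness\<close>

text \<open>By Cauchy condensation, since ln(2^n + 1) lies between n ln 2 and (n+1) ln 2, the two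
  series compare with the sums of 1/n and 1/n^2. They control the integral of the spikes against the
  dual window and their squared L2 norm.\<close>

lemma summable_inverse_log:
  "\<not> summable (\<lambda>j. 1 / (real (Suc j) * ln (real j + 2)))"
  "summable (\<lambda>j. 1 / (real (Suc j) * (ln (real j + 2))\<^sup>2))"
proof -
  have shift: "(\<lambda>j. f (Suc j)) = (\<lambda>j. 1 / (real (Suc j) * g (ln (real j + 2))))"
    if "\<And>n. f n = 1 / (real n * g (ln (real n + 1)))" for f g :: "_ \<Rightarrow> real"
    using that by (simp add: add_ac)
  define f1 where "f1 n = 1 / (real n * ln (real n + 1))" for n
  define f2 where "f2 n = 1 / (real n * (ln (real n + 1))\<^sup>2)" for n
  have lnpos: "0 < ln (real n + 1)" if "n > 0" for n using that by simp
  have c1: "summable f1 \<longleftrightarrow> summable (\<lambda>n. 2 ^ n * f1 (2 ^ n))"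
  proof (rule condensation_test)
    show "f1 (Suc m) \<le> f1 m" if "m > 0" for m
      unfolding f1_def using that lnpos[OF that]
      by (intro divide_left_mono mult_mono mult_pos_pos) auto
  qed (simp add: f1_def)
  have c2: "summable f2 \<longleftrightarrow> summable (\<lambda>n. 2 ^ n * f2 (2 ^ n))"
  proof (rule condensation_test)
    show "f2 (Suc m) \<le> f2 m" if "m > 0" for m
      unfolding f2_def using that lnpos[OF that]
      by (intro divide_left_mono mult_mono power_mono mult_pos_pos) auto
  qed (simp add: f2_def)
  have lo: "real n * ln 2 \<le> ln (2 ^ n + 1)" for n
  proof -
    have "real n * ln 2 = ln (2 ^ n)" by (simp add: ln_realpow)
    also have "\<dots> \<le> ln (2 ^ n + 1)"
      by (subst ln_le_cancel_iff) (auto simp: add_pos_pos)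
    finally show ?thesis .
  qed
  have hi: "ln (2 ^ n + 1) \<le> real (Suc n) * ln 2" for n
  proof -
    have "ln (2 ^ n + 1) \<le> ln (2 ^ Suc n :: real)"
      by (subst ln_le_cancel_iff) (auto simp: add_pos_pos)
    then show ?thesis by (simp only: ln_realpow)
  qed
  have "\<not> summable (\<lambda>n. 2 ^ n * f1 (2 ^ n))"
  proof
    assume "summable (\<lambda>n. 2 ^ n * f1 (2 ^ n))"
    then have "summable (\<lambda>n. ln 2 * (2 ^ n * f1 (2 ^ n)))" by (rule summable_mult)
    then have "summable (\<lambda>n. inverse (real (Suc n)))"
    proof (rule summable_comparison_test')
      fix n :: nat
      have "0 < ln (2 ^ n + 1 :: real)" by (rule ln_gt_zero) simp
      then have "ln 2 / (real (Suc n) * ln 2) \<le> ln 2 / ln (2 ^ n + 1 :: real)"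
        using hi[of n] by (intro divide_left_mono mult_pos_pos) auto
      moreover have "2 ^ n * f1 (2 ^ n) = 1 / ln (2 ^ n + 1)" by (simp add: f1_def)
      ultimately show "norm (inverse (real (Suc n))) \<le> ln 2 * (2 ^ n * f1 (2 ^ n))"
        by (simp add: inverse_eq_divide)
    qed
    then show False using not_summable_harmonic[where 'a = real] summable_Suc_iff[of "\<lambda>n. inverse (real n)"] by simp
  qed
  then have "\<not> summable f1" using c1 by simp
  then show "\<not> summable (\<lambda>j. 1 / (real (Suc j) * ln (real j + 2)))"
    using summable_Suc_iff[of f1] shift[of f1 "\<lambda>x. x"] by (simp add: f1_def[abs_def])
  \<comment> \<open>The index starts at one because the lower bound n ln 2 is zero at n = 0.\<close>
  have "summable (\<lambda>n. 2 ^ Suc n * f2 (2 ^ Suc n))"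
  proof (rule summable_comparison_test')
    have "summable (\<lambda>n. inverse (real n ^ 2))"
      using inverse_power_summable[of 2, where 'a = real] by simp
    then have "summable (\<lambda>n. inverse (real (Suc n) ^ 2))"
      by (subst summable_Suc_iff)
    then show "summable (\<lambda>n. (1 / (ln 2)\<^sup>2) * inverse (real (Suc n) ^ 2))"
      by (rule summable_mult)
    fix n :: nat
    have "(real (Suc n) * ln 2)\<^sup>2 \<le> (ln (2 ^ Suc n + 1))\<^sup>2"
      using lo[of "Suc n"] by (intro power_mono) auto
    then have "1 / (ln (2 ^ Suc n + 1))\<^sup>2 \<le> 1 / (real (Suc n) * ln 2)\<^sup>2"
      by (intro divide_left_mono mult_pos_pos zero_less_power ln_gt_zero) auto
    moreover have "2 ^ Suc n * f2 (2 ^ Suc n) = 1 / (ln (2 ^ Suc n + 1))\<^sup>2"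
      unfolding f2_def by simp
    ultimately show "norm (2 ^ Suc n * f2 (2 ^ Suc n)) \<le> (1 / (ln 2)\<^sup>2) * inverse (real (Suc n) ^ 2)"
      by (simp only: power_mult_distrib inverse_eq_divide norm_divide real_norm_def) (simp add: mult_ac)
  qed
  then have "summable f2" unfolding c2 by (subst (asm) summable_Suc_iff)
  then show "summable (\<lambda>j. 1 / (real (Suc j) * (ln (real j + 2))\<^sup>2))"
    using summable_Suc_iff[of f2] shift[of f2 "\<lambda>x. x\<^sup>2"] by (simp add: f2_def[abs_def])
qed

text \<open>The length 1 / (2(j+1)) is that of a stretch below j + 1/2 on which the dual window is
  bounded away from zero uniformly in j.\<close>

definition spike :: "nat \<Rightarrow> real set" where
  "spike j = {real j + 1/2 - 1 / (2 * real (Suc j))..<real j + 1/2}"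

text \<open>Spike j lies in the cell with index j, so at most one spike contains t and
  \<open>cell t\<close> selects it. No infinite sum is needed.\<close>

definition spike_sum :: "real \<Rightarrow> real" where
  "spike_sum t = (if t \<in> spike (cell t) then 1 / ln (real (cell t) + 2) else 0)"

lemma cell_spike: "t \<in> spike j \<Longrightarrow> cell t = j"
proof -
  assume t: "t \<in> spike j"
  have "1 / (2 * real (Suc j)) \<le> 1 / 2" by (simp add: field_simps)
  moreover have "real j + 1/2 - 1 / (2 * real (Suc j)) \<le> t" and ub: "t < real j + 1/2"
    using t unfolding spike_def by simp_all
  ultimately have "real j \<le> t" by linarith
  note this ub
  then have "\<lfloor>t + 1/2\<rfloor> = int j" by (intro floor_unique) auto
  then show ?thesis by (simp add: cell_def)
qed

lemma disjoint_spike: "disjoint_family spike"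
  unfolding disjoint_family_on_def using cell_spike by blast

lemma spike_sets [measurable]: "spike j \<in> sets borel"
  by (simp add: spike_def)

lemma emeasure_spike: "emeasure lborel (spike j) = ennreal (1 / (2 * real (Suc j)))"
  by (simp add: spike_def)

lemma spike_sum_nonneg: "0 \<le> spike_sum t"
  by (simp add: spike_sum_def)

lemma spike_sum_measurable [measurable]: "spike_sum \<in> borel_measurable borel"
proof -
  have "spike_sum = (\<lambda>t. if real (cell t) + 1/2 - 1 / (2 * real (Suc (cell t))) \<le> t \<and> t < real (cell t) + 1/2
      then 1 / ln (real (cell t) + 2) else 0)"
    by (auto simp: spike_sum_def spike_def fun_eq_iff)
  also have "\<dots> \<in> borel_measurable borel" by measurable
  finally show ?thesis .
qed

lemma spike_sum_square_integrable: "integrable lborel (\<lambda>t. (spike_sum t)\<^sup>2)"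
proof (rule integrableI_bounded)
  let ?a = "\<lambda>j. 1 / (ln (real j + 2))\<^sup>2"
  have eq: "ennreal (norm ((spike_sum t)\<^sup>2)) \<le> (\<Sum>j. ennreal (?a j) * indicator (spike j) t)" for t
  proof (cases "t \<in> spike (cell t)")
    case True
    have "ennreal (norm ((spike_sum t)\<^sup>2)) = (\<Sum>j\<in>{cell t}. ennreal (?a j) * indicator (spike j) t)"
      using True by (simp add: spike_sum_def power_divide)
    also have "\<dots> \<le> (\<Sum>j. ennreal (?a j) * indicator (spike j) t)"
      by (rule sum_le_suminf) auto
    finally show ?thesis .
  qed (simp add: spike_sum_def)
  have "(\<integral>\<^sup>+t. ennreal (norm ((spike_sum t)\<^sup>2)) \<partial>lborel) \<le> (\<integral>\<^sup>+t. (\<Sum>j. ennreal (?a j) * indicator (spike j) t) \<partial>lborel)"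
    by (rule nn_integral_mono) (rule eq)
  also have "\<dots> = (\<Sum>j. \<integral>\<^sup>+t. ennreal (?a j) * indicator (spike j) t \<partial>lborel)"
    by (rule nn_integral_suminf) measurable
  also have "\<dots> = (\<Sum>j. ennreal (1/2 * (1 / (real (Suc j) * (ln (real j + 2))\<^sup>2))))"
    by (rule suminf_cong, subst nn_integral_cmult_indicator)
       (auto simp: emeasure_spike field_simps simp flip: ennreal_mult)
  also have "\<dots> < \<infinity>"
    unfolding infinity_ennreal_def less_top [symmetric]
    by (rule ennreal_suminf_neq_top[OF summable_mult[OF summable_inverse_log(2)]]) simp
  finally show "(\<integral>\<^sup>+t. ennreal (norm ((spike_sum t)\<^sup>2)) \<partial>lborel) < \<infinity>" .
qed measurable

text \<open>For r = j + 1/2 - t, the exponent t^2 - (j + 1/2)^2 = -r (2j + 1 - r) is at least -1,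
  because r \<le> 1 / (2(j+1)).\<close>

lemma dual_window_spike_ge: "t \<in> spike j \<Longrightarrow> 2/3 * exp (- pi) \<le> \<bar>dual_window t\<bar>"
proof -
  assume t: "t \<in> spike j"
  have c: "cell t = j" by (rule cell_spike[OF t])
  define r where "r = real j + 1/2 - t"
  have r: "0 \<le> r" "r \<le> 1 / (2 * real (Suc j))" using t by (auto simp: r_def spike_def)
  have "t\<^sup>2 - (real j + 1/2)\<^sup>2 = - (r * (2 * real j + 1 - r))"
    by (simp add: r_def power2_eq_square algebra_simps)
  moreover have "r * (2 * real j + 1 - r) \<le> 1 / (2 * real (Suc j)) * (2 * real (Suc j))"
  proof (intro mult_mono r)
    have "r \<le> 1 / 2" by (rule order_trans[OF r(2)]) (simp add: field_simps)
    then show "0 \<le> 2 * real j + 1 - r" by simp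
  qed (use r in auto)
  ultimately have "- 1 \<le> t\<^sup>2 - (real j + 1/2)\<^sup>2" by simp
  then have "pi * - 1 \<le> pi * (t\<^sup>2 - (real j + 1/2)\<^sup>2)" by (intro mult_left_mono) auto
  then have "exp (- pi) \<le> exp (pi * (t\<^sup>2 - (real (cell t) + 1/2)\<^sup>2))" by (simp add: c)
  from order_trans[OF mult_left_mono[OF this] dual_window_bounds(1)] show ?thesis by simp
qed

lemma dual_window_spike_sum_not_integrable:
  "\<not> integrable lborel (\<lambda>t. \<bar>dual_window t\<bar> * spike_sum t)"
proof
  assume int: "integrable lborel (\<lambda>t. \<bar>dual_window t\<bar> * spike_sum t)"
  let ?c = "\<lambda>j. 2/3 * exp (- pi) * (1 / ln (real j + 2))"
  have "summable (\<lambda>j. ?c j * measure lborel (spike j))"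
  proof (rule summable_integrable_disjoint[OF int _ disjoint_spike])
    show "?c j \<le> \<bar>dual_window t\<bar> * spike_sum t" if "t \<in> spike j" for j t
    proof -
      have "spike_sum t = 1 / ln (real j + 2)"
        using that cell_spike[OF that] by (simp add: spike_sum_def)
      then show ?thesis
        using mult_right_mono[OF dual_window_spike_ge[OF that] spike_sum_nonneg[of t]] by simp
    qed
  qed (auto simp: spike_sum_nonneg emeasure_spike)
  \<comment> \<open>The factor 3 exp(\<pi>) undoes the lower bound 2/3 exp(-\<pi>) and the 1/2 from
    the spike length.\<close>
  then have "summable (\<lambda>j. (3 * exp pi) * (?c j * measure lborel (spike j)))"
    by (rule summable_mult)
  also have "(\<lambda>j. (3 * exp pi) * (?c j * measure lborel (spike j))) = (\<lambda>j. 1 / (real (Suc j) * ln (real j + 2)))"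
  proof
    fix j
    have "exp pi * exp (- pi) = 1" by (simp flip: exp_add)
    moreover have "(3 * exp pi) * (?c j * measure lborel (spike j))
        = (exp pi * exp (- pi)) * (1 / (real (Suc j) * ln (real j + 2)))"
      by (simp add: measure_def emeasure_spike del: of_nat_Suc)
    ultimately show "(3 * exp pi) * (?c j * measure lborel (spike j)) = 1 / (real (Suc j) * ln (real j + 2))"
      by simp
  qed
  finally show False using summable_inverse_log(1) by simp
qed

lemma L2_mult_cnj_integrable:
  assumes "f \<in> L2 M" "g \<in> L2 M"
  shows "integrable M (\<lambda>x. f x * cnj (g x))"
proof -
  have [measurable]: "cnj \<in> borel_measurable borel"
    by (intro borel_measurable_continuous_onI continuous_intros)
  have [measurable]: "f \<in> borel_measurable M" "g \<in> borel_measurable M"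
    and int: "integrable M (\<lambda>x. (norm (f x))\<^sup>2 + (norm (g x))\<^sup>2)"
    using assms by (auto simp: L2_def)
  show ?thesis
  proof (rule Bochner_Integration.integrable_bound[OF int])
    have "norm (f x * cnj (g x)) \<le> (norm (f x))\<^sup>2 + (norm (g x))\<^sup>2" for x
    proof -
      have "norm (f x * cnj (g x)) \<le> 2 * norm (f x) * norm (g x)" by (simp add: norm_mult)
      also have "\<dots> \<le> (norm (f x))\<^sup>2 + (norm (g x))\<^sup>2" by (rule sum_squares_bound)
      finally show ?thesis .
    qed
    then show "AE x in M. norm (f x * cnj (g x)) \<le> norm ((norm (f x))\<^sup>2 + (norm (g x))\<^sup>2)"
      by simp
  qed measurable
qed

text \<open>Away from multiples of 2\<pi> the sums are real parts of geometric sums, hence bounded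
  by 2 / |exp(i\<tau>) - 1| for every N.\<close>

lemma cos_averages_tendsto_0:
  assumes "exp (\<i> * of_real \<tau>) \<noteq> 1"
  shows "(\<lambda>N. (\<Sum>n<N. cos (real n * \<tau>)) / real N) \<longlonglongrightarrow> 0"
proof (rule tendsto_0_le)
  let ?z = "exp (\<i> * of_real \<tau>)"
  show "(\<lambda>N. 1 / real N) \<longlonglongrightarrow> 0" by (rule lim_1_over_n)
  show "\<forall>\<^sub>F N in sequentially. norm ((\<Sum>n<N. cos (real n * \<tau>)) / real N) \<le> norm (1 / real N) * (2 / norm (?z - 1))"
  proof (rule always_eventually, rule allI)
    fix N
    have "(\<Sum>n<N. cos (real n * \<tau>)) = Re (\<Sum>n<N. ?z ^ n)"
      by (simp add: Re_exp mult.assoc flip: exp_of_nat_mult)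
    also have "\<bar>\<dots>\<bar> \<le> norm (\<Sum>n<N. ?z ^ n)" by (rule abs_Re_le_cmod)
    also have "\<dots> = norm (?z ^ N - 1) / norm (?z - 1)"
      using geometric_sum[OF assms] by (simp add: norm_divide)
    also have "\<dots> \<le> 2 / norm (?z - 1)"
      using norm_triangle_ineq4[of "?z ^ N" 1] by (intro divide_right_mono) (auto simp: norm_power)
    finally show "norm ((\<Sum>n<N. cos (real n * \<tau>)) / real N) \<le> norm (1 / real N) * (2 / norm (?z - 1))"
      by (cases "N = 0") (auto simp: field_simps)
  qed
qed

text \<open>
  The uniform boundedness principle is replaced by an explicit \<open>u\<close>: the heights \<open>1 / ln (j + 2)\<close> on intervals
  of length about \<open>1 / (2j)\<close> are chosen so that \<open>u\<close> is square integrable while \<open>u\<close> times the dual window is not integrable.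
\<close>

lemma dual_diff_inner_unbounded:
  defines "u \<equiv> \<lambda>t. complex_of_real (sgn (dual_window t) * spike_sum t)"
  shows "u \<in> L2 lborel" "\<not> (\<exists>B. \<forall>n. norm (L2_inner lborel u (dual_diff n)) \<le> B)"
proof -
  have [measurable]: "u \<in> borel_measurable borel" unfolding u_def by measurable
  have "integrable lborel (\<lambda>t. (norm (u t))\<^sup>2)"
    by (rule Bochner_Integration.integrable_bound[OF spike_sum_square_integrable])
       (auto simp: u_def norm_mult power_mult_distrib sgn_if)
  then show u: "u \<in> L2 lborel" by (simp add: L2_def)
  define h where "h t = \<bar>dual_window t\<bar> * spike_sum t" for t
  have h0: "0 \<le> h t" for t by (simp add: h_def spike_sum_nonneg)
  have [measurable]: "h \<in> borel_measurable lborel" unfolding h_def by measurable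
  let ?\<tau> = "\<lambda>t. 2 * pi * (t - 1/2)"
  show "\<not> (\<exists>B. \<forall>n. norm (L2_inner lborel u (dual_diff n)) \<le> B)"
  proof
    assume "\<exists>B. \<forall>n. norm (L2_inner lborel u (dual_diff n)) \<le> B"
    then obtain B where B: "\<And>n. norm (L2_inner lborel u (dual_diff n)) \<le> B" by blast
    \<comment> \<open>The sign in u turns the product with the window into h =
      |\<open>dual_window\<close>| \<open>spike_sum\<close>, so the real part is nonnegative, as
      Fatou's lemma requires.\<close>
    have Re_eq: "Re (u t * cnj (dual_diff n t)) = h t * (1 - cos (real n * ?\<tau> t))" for n t
    proof -
      have "exp (2 * pi * \<i> * of_nat n * of_real (t - 1/2)) = exp (\<i> * of_real (real n * ?\<tau> t))"
        by (rule arg_cong[of _ _ exp]) (simp add: algebra_simps)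
      then have "u t * cnj (dual_diff n t)
          = of_real (sgn (dual_window t) * dual_window t * spike_sum t) * (1 - cnj (exp (\<i> * of_real (real n * ?\<tau> t))))"
        unfolding u_def dual_diff_def by simp
      also have "sgn (dual_window t) * dual_window t * spike_sum t = h t"
        by (simp add: h_def sgn_if)
      finally show ?thesis by (simp add: Re_exp)
    qed
    have int: "integrable lborel (\<lambda>t. h t * (1 - cos (real n * ?\<tau> t)))" for n
      using integrable_Re[OF L2_mult_cnj_integrable[OF u dual_diff_L2[of n]]] unfolding Re_eq .
    have le: "(LINT t|lborel. h t * (1 - cos (real n * ?\<tau> t))) \<le> B" for n
    proof -
      have "(LINT t|lborel. h t * (1 - cos (real n * ?\<tau> t))) = Re (L2_inner lborel u (dual_diff n))"
        unfolding L2_inner_def Re_eq [symmetric] by (rule integral_Re[OF L2_mult_cnj_integrable[OF u dual_diff_L2]])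
      also have "\<dots> \<le> B" using complex_Re_le_cmod B by (rule order_trans)
      finally show ?thesis .
    qed
    \<comment> \<open>Averaging over n removes the cosine in the limit and keeps the bound
      B.\<close>
    define H where "H N t = (\<Sum>n<Suc N. h t * (1 - cos (real n * ?\<tau> t))) / real (Suc N)" for N t
    have H_int: "integrable lborel (H N)" for N
      unfolding H_def by (intro integrable_divide Bochner_Integration.integrable_sum int)
    have H0: "0 \<le> H N t" for N t
      unfolding H_def by (intro divide_nonneg_nonneg sum_nonneg mult_nonneg_nonneg h0) auto
    have H_le: "(\<integral>\<^sup>+t. ennreal (H N t) \<partial>lborel) \<le> ennreal B" for N
    proof -
      have "integral\<^sup>L lborel (H N) = (\<Sum>n<Suc N. LINT t|lborel. h t * (1 - cos (real n * ?\<tau> t))) / real (Suc N)"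
        unfolding H_def by (simp add: int del: sum.lessThan_Suc)
      also have "\<dots> \<le> (\<Sum>n<Suc N. B) / real (Suc N)"
        by (intro divide_right_mono sum_mono le) auto
      also have "\<dots> = B" by (simp add: field_simps del: sum.lessThan_Suc)
      finally have "integral\<^sup>L lborel (H N) \<le> B" .
      then show ?thesis
        using nn_integral_eq_integral[OF H_int] H0 by (simp add: ennreal_leI)
    qed
    have H_lim: "(\<lambda>N. H N t) \<longlonglongrightarrow> h t" for t
    proof (cases "t \<in> spike (cell t)")
      case False
      then show ?thesis by (simp add: H_def h_def spike_sum_def)
    next
      case True
      \<comment> \<open>The spike is open at its right end and shorter than one, so t - 1/2 lies
        strictly between two consecutive integers.\<close>
      have "exp (\<i> * of_real (?\<tau> t)) \<noteq> 1"
      proof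
        assume "exp (\<i> * of_real (?\<tau> t)) = 1"
        then obtain k :: int where "?\<tau> t = of_int (2 * k) * pi"
          by (auto simp: exp_eq_1)
        then have "t - 1/2 = of_int k" by simp
        moreover have "real (cell t) - 1 < t - 1/2" "t - 1/2 < real (cell t)"
        proof -
          have "1 / (2 * real (Suc (cell t))) \<le> 1 / 2" by (simp add: field_simps)
          moreover have "real (cell t) + 1/2 - 1 / (2 * real (Suc (cell t))) \<le> t" "t < real (cell t) + 1/2"
            using True unfolding spike_def by simp_all
          ultimately show "real (cell t) - 1 < t - 1/2" "t - 1/2 < real (cell t)" by linarith+
        qed
        ultimately have "real_of_int (int (cell t) - 1) < of_int k" "of_int k < real_of_int (int (cell t))"
          by simp_all
        then show False by (simp only: of_int_less_iff)
      qed
      note lim = LIMSEQ_Suc[OF cos_averages_tendsto_0[OF this]]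
      have "(\<lambda>N. h t * (1 - (\<Sum>n<Suc N. cos (real n * ?\<tau> t)) / real (Suc N))) \<longlonglongrightarrow> h t * (1 - 0)"
        by (rule tendsto_mult[OF tendsto_const tendsto_diff[OF tendsto_const lim]])
      moreover have "h t * (1 - (\<Sum>n<Suc N. cos (real n * ?\<tau> t)) / real (Suc N)) = H N t" for N
        unfolding H_def sum_distrib_left [symmetric] sum_subtractf
        by (simp add: field_simps del: sum.lessThan_Suc)
      ultimately show ?thesis by simp
    qed
    have "(\<integral>\<^sup>+t. ennreal (h t) \<partial>lborel) = (\<integral>\<^sup>+t. liminf (\<lambda>N. ennreal (H N t)) \<partial>lborel)"
      by (intro nn_integral_cong lim_imp_Liminf[symmetric] tendsto_ennrealI H_lim) auto
    also have "\<dots> \<le> liminf (\<lambda>N. \<integral>\<^sup>+t. ennreal (H N t) \<partial>lborel)"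
      by (rule nn_integral_liminf) (use H_int in measurable)
    also have "\<dots> \<le> ennreal B"
      by (rule Liminf_le) (use H_le in \<open>auto intro: always_eventually\<close>)
    also have "\<dots> < \<infinity>" by simp
    finally have "(\<integral>\<^sup>+t. ennreal (norm (h t)) \<partial>lborel) < \<infinity>"
      unfolding real_norm_def abs_of_nonneg[OF h0] .
    then have "integrable lborel h"
      by (rule integrableI_bounded[rotated]) measurable
    then show False
      using dual_window_spike_sum_not_integrable unfolding h_def by simp
  qed
qed

section \<open>Reproducing partners\<close>

lemma gabor_gaussian_no_reproducing_partner:
  "\<not> has_reproducing_partner (lborel :: real measure) (UNIV :: (int \<times> int) set) (gabor_system gaussian)"
proof
  let ?M = "lborel :: real measure" and ?\<phi> = "gabor_system gaussian"
  assume "has_reproducing_partner ?M (UNIV :: (int \<times> int) set) ?\<phi>"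
  then obtain \<psi> J and e :: "nat \<Rightarrow> int \<times> int" and S where
      J: "J = UNIV \<or> (\<exists>m. J = {..<m})" and e: "bij_betw e J UNIV"
      and S: "L2_bounded_operator ?M S" "L2_boundedly_invertible ?M S"
      and conv: "\<And>f g. f \<in> L2 ?M \<Longrightarrow> g \<in> L2 ?M \<Longrightarrow>
        (\<lambda>N. \<Sum>n\<in>J \<inter> {..<N}. L2_inner ?M f (\<psi> (e n)) * L2_inner ?M (?\<phi> (e n)) g) \<longlonglongrightarrow> L2_inner ?M (S f) g"
    unfolding has_reproducing_partner_def reproducing_pair_def by blast
  have "infinite (UNIV :: (int \<times> int) set)"
    by (simp add: finite_prod)
  then have "J = UNIV"
    using J bij_betw_finite[OF e] by auto
  with e have e: "bij e" by simp
  define u where "u t = complex_of_real (sgn (dual_window t) * spike_sum t)" for t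
  have u: "u \<in> L2 ?M" "\<not> (\<exists>B. \<forall>n. norm (L2_inner ?M u (dual_diff n)) \<le> B)"
    using dual_diff_inner_unbounded by (simp_all add: u_def[abs_def])
  \<comment> \<open>Taking f = T u makes the reproducing formula an expansion of u itself, with
    coefficients c.\<close>
  obtain T where T: "L2_bounded_operator ?M T" "AE x in ?M. S (T u) x = u x"
    using S(2) u(1) by (auto simp: L2_boundedly_invertible_def)
  have Tu: "T u \<in> L2 ?M" and STu: "S (T u) \<in> L2 ?M"
    using T(1) S(1) u(1) by (auto simp: L2_bounded_operator_def)
  define c where "c i = L2_inner ?M (T u) (\<psi> i)" for i
  have lim: "(\<lambda>N. \<Sum>n<N. c (e n) * L2_inner ?M (?\<phi> (e n)) g) \<longlonglongrightarrow> L2_inner ?M u g" if g: "g \<in> L2 ?M" for g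
  proof -
    have "L2_inner ?M (S (T u)) g = L2_inner ?M u g"
      unfolding L2_inner_def
    proof (rule integral_cong_AE)
      show "AE x in ?M. S (T u) x * cnj (g x) = u x * cnj (g x)"
        using T(2) by eventually_elim simp
    qed (use L2_mult_cnj_integrable[OF STu g] L2_mult_cnj_integrable[OF u(1) g] in auto)
    then show ?thesis using conv[OF Tu g] by (simp add: \<open>J = UNIV\<close> c_def)
  qed
  \<comment> \<open>The terms of a convergent series are bounded, and the enumeration reaches every
    index, so the bound does not depend on the ordering.\<close>
  have "\<exists>B. \<forall>n. norm (c (0, int n) * L2_inner ?M (?\<phi> (0, int n)) g) \<le> B" if g: "g \<in> L2 ?M" for g
  proof -
    have "summable (\<lambda>n. c (e n) * L2_inner ?M (?\<phi> (e n)) g)"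
      using lim[OF g] by (auto simp: summable_def sums_def)
    then have "(\<lambda>n. c (e n) * L2_inner ?M (?\<phi> (e n)) g) \<longlonglongrightarrow> 0"
      by (rule summable_LIMSEQ_zero)
    then have "Bseq (\<lambda>n. c (e n) * L2_inner ?M (?\<phi> (e n)) g)"
      by (rule convergentI[THEN convergent_imp_Bseq])
    then obtain B where B: "\<And>n. norm (c (e n) * L2_inner ?M (?\<phi> (e n)) g) \<le> B"
      by (auto simp: Bseq_def)
    have "norm (c i * L2_inner ?M (?\<phi> i) g) \<le> B" for i
      using B[of "inv e i"] e by (simp add: bij_is_surj surj_f_inv_f)
    then show ?thesis by blast
  qed
  from coefficients_bounded[of "\<lambda>n. c (0, int n)", OF this]
  obtain B where B: "\<And>n. norm (c (0, int n)) \<le> B" by auto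
  have "norm (L2_inner ?M u (dual_diff n)) \<le> dual_const * (B + B)" for n
  proof -
    let ?t = "\<lambda>i. c i * L2_inner ?M (?\<phi> i) (dual_diff n)"
    let ?p = "inv e (0, 0)" and ?q = "inv e (0, int n)"
    have ep: "e m = (0, 0) \<longleftrightarrow> m = ?p" and eq: "e m = (0, int n) \<longleftrightarrow> m = ?q" for m
      using e by (metis bij_inv_eq_iff)+
    define z where "z = exp (\<i> * complex_of_real pi * of_nat n)"
    have z: "norm z = 1" by (simp add: z_def)
    have t: "?t (e m) = (if m = ?p then of_real dual_const * c (0, 0) else 0)
        - (if m = ?q then of_real dual_const * z * c (0, int n) else 0)" for m
    proof -
      obtain k l where kl: "e m = (k, l)" by (cases "e m")
      have "?t (e m) = c (e m) * (of_real dual_const * ((if e m = (0, 0) then 1 else 0) - z * (if e m = (0, int n) then 1 else 0)))"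
        unfolding kl gabor_dual_diff_inner z_def by simp
      also have "\<dots> = (if e m = (0, 0) then of_real dual_const * c (0, 0) else 0)
          - (if e m = (0, int n) then of_real dual_const * z * c (0, int n) else 0)"
        by (simp add: algebra_simps split: if_split)
      finally show ?thesis unfolding ep eq .
    qed
    \<comment> \<open>Once both positions \<open>?p\<close> and \<open>?q\<close> have been passed,
      the partial sums are constant.\<close>
    have "\<forall>\<^sub>F N in sequentially. (\<Sum>m<N. ?t (e m)) = of_real dual_const * (c (0, 0) - z * c (0, int n))"
      using eventually_gt_at_top[of "max ?p ?q"]
    proof eventually_elim
      case (elim N)
      then show ?case
        unfolding t sum_subtractf by (simp add: sum.delta algebra_simps)
    qed
    then have "(\<lambda>N. \<Sum>m<N. ?t (e m)) \<longlonglongrightarrow> of_real dual_const * (c (0, 0) - z * c (0, int n))"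
      by (rule tendsto_eventually)
    with lim[OF dual_diff_L2[of n]]
    have "L2_inner ?M u (dual_diff n) = of_real dual_const * (c (0, 0) - z * c (0, int n))"
      by (rule LIMSEQ_unique)
    also have "norm \<dots> \<le> dual_const * (norm (c (0, 0)) + norm (c (0, int n)))"
      using dual_const_pos norm_triangle_ineq4[of "c (0, 0)" "z * c (0, int n)"]
      by (simp add: norm_mult z)
    also have "\<dots> \<le> dual_const * (B + B)"
      using dual_const_pos B[of 0] B[of n] by (intro mult_left_mono add_mono) auto
    finally show ?thesis .
  qed
  with u(2) show False by blast
qed

theorem corollary4p4:
  fixes \<Theta> :: "real \<times> real \<Rightarrow> complex"
  assumes "\<Theta> = Zak gaussian"
  shows "(AE p in square_measure. \<Theta> p \<noteq> 0)
    \<and> (\<lambda>p. 1 / \<Theta> p) \<notin> L2 square_measure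
    \<and> (\<lambda>p. complex_of_real (rho (1/2) (1/2) p) / \<Theta> p) \<in> L2 square_measure
    \<and> \<not> has_reproducing_partner (lborel :: real measure) (UNIV :: (int \<times> int) set) (gabor_system gaussian)"
  unfolding assms
  by (intro conjI Zak_gaussian_properties gabor_gaussian_no_reproducing_partner)

end
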